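(* Let $0\le m\le n$ with $m\in\mathbb{Z}$ and $n\in\mathbb{N}$, $n\geq 1$. Let $A\subset\mathbb{R}^n$ be Lebesgue measurable, let $X$ be an arbitrary metric space, and let $f:A\to X$ be Lipschitz. Then for $\mathcal{H}^m$-almost every $z\in X$, the fiber $f^{-1}(z)\subset A$ is countably $\mathcal{H}^{n-m}$-rectifiable.
   Context: $\mathcal{H}^s$ denotes the $s$-dimensional Hausdorff measure, normalized so that $\mathcal{H}^n$ equals Lebesgue measure on $\mathbb{R}^n$; $\mathcal{H}^0$ is the counting measure. For integers $0\le k\le n$, a set $E\subset\mathbb{R}^n$ is countably $\mathcal{H}^k$-rectifiable if there are sets $A_i\subset\mathbb{R}^k$ and Lipschitz maps $f_i:A_i\to\mathbb{R}^n$, $i=1,2,\dots$, such that $\mathcal{H}^k\big(E\setminus\bigcup_{i=1}^\infty f_i(A_i)\big)=0$. In particular, countably $\mathcal{H}^0$-rectifiable sets are the same as countable (possibly finite or empty) sets. *)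

theory Defs
  imports "HOL-Analysis.Analysis"
begin

text \<open>
  The weight of a covering set is \<open>\<omega>\<^sub>s (diam S / 2)\<^sup>s\<close>, where \<open>\<omega>\<^sub>s = \<pi>\<^bsup>s/2\<^esup> / \<Gamma>(s/2 + 1)\<close>; this constant
  makes the \<open>n\<close>-dimensional measure on \<open>n\<close>-dimensional Euclidean space equal to Lebesgue measure.
  For \<open>s = 0\<close> a nonempty set has weight 1 (counting measure); this case is separate because
  \<^term>\<open>0 powr 0 = (0::real)\<close>.
\<close>

definition hausdorff_weight :: "real \<Rightarrow> 'a::metric_space set \<Rightarrow> ennreal" where
  "hausdorff_weight s S =
     (if S = {} then 0
      else if s = 0 then 1
      else ennreal (unit_ball_vol s * (diameter S / 2) powr s))"

text \<open>
  Boundedness of the covering sets is required explicitly because \<^const>\<open>diameter\<close> is real-valued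
  and carries no information for unbounded sets. If \<open>E\<close> has no admissible countable cover, the
  infimum is \<open>\<infinity>\<close>.
\<close>

definition hausdorff_delta :: "real \<Rightarrow> real \<Rightarrow> 'a::metric_space set \<Rightarrow> ennreal" where
  "hausdorff_delta s \<delta> E =
     (INF C \<in> {C :: nat \<Rightarrow> 'a set. E \<subseteq> (\<Union>i. C i) \<and> (\<forall>i. bounded (C i) \<and> diameter (C i) \<le> \<delta>)}.
        \<Sum>i. hausdorff_weight s (C i))"

text \<open>The Hausdorff (outer) measure, defined on all subsets of a metric space.\<close>

definition hausdorff_measure :: "real \<Rightarrow> 'a::metric_space set \<Rightarrow> ennreal" where
  "hausdorff_measure s E = (SUP \<delta> \<in> {0<..}. hausdorff_delta s \<delta> E)"

text \<open>
  Here the space of real \<open>k\<close>-tuples is the carrier of \<^term>\<open>Euclidean_space k\<close>, i.e. the sequences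
  that vanish from index \<open>k\<close> on, so that \<open>k\<close> may be any natural number, including 0. The Lipschitz
  condition is spelled out with the Euclidean norm of \<open>x - y\<close>, since the type class metric on
  \<open>nat \<Rightarrow> real\<close> is not the Euclidean one.
\<close>

definition countably_rectifiable :: "nat \<Rightarrow> (real ^ 'n) set \<Rightarrow> bool" where
  "countably_rectifiable k E \<longleftrightarrow>
     (\<exists>(A :: nat \<Rightarrow> (nat \<Rightarrow> real) set) (f :: nat \<Rightarrow> (nat \<Rightarrow> real) \<Rightarrow> real ^ 'n).
        (\<forall>i. A i \<subseteq> topspace (Euclidean_space k) \<and>
             (\<exists>L\<ge>0. \<forall>x\<in>A i. \<forall>y\<in>A i. dist (f i x) (f i y) \<le> L * L2_set (\<lambda>j. x j - y j) {..<k})) \<and>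
        hausdorff_measure (real k) (E - (\<Union>i. f i ` A i)) = 0)"

end

theory Submission
  imports Defs
begin

text \<open>
  Put \<open>n = CARD('n)\<close> and \<open>k = n - m\<close>. The map \<open>f\<close> enters only through the pseudometric
  \<open>D x y = dist (f x) (f y)\<close> on \<open>A\<close>, which extends to a pseudometric on the whole Euclidean space with
  \<open>D x y \<le> L * dist x y\<close> (\<open>lipschitz_pseudometric_extension\<close>). A fibre of \<open>f\<close> is a subset of \<open>A\<close> on
  which \<open>D\<close> vanishes.

  Call \<open>v\<close> a null direction at \<open>x\<close> if \<open>D x (x + t v) = o(t)\<close>. A weak form of the almost everywhere
  metric differentiability of \<open>D\<close> holds (\<open>negligible_not_regular_point\<close>): outside a Lebesgue null set
  the null directions at \<open>x\<close> form a subspace, and it contains every \<open>v\<close> for which merely the lower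
  limit of \<open>D x (x + t v) / t\<close> as \<open>t\<close> decreases to 0 vanishes. This gives a dichotomy for the points
  \<open>x\<close> outside the null set.

  If the null directions at \<open>x\<close> have dimension at most \<open>k\<close>, then some linear map \<open>T\<close> to \<open>k\<close>-dimensional
  space satisfies \<open>|y - x| \<le> 3 |T (y - x)|\<close> for all points \<open>y\<close> near \<open>x\<close> of the fibre through \<open>x\<close>
  (\<open>fibre_cone_of_dim\<close>), and \<open>T\<close> can be taken from a countable family. The points of a fibre with this
  property therefore split into countably many Lipschitz graphs over subsets of
  \<open>k\<close>-dimensional space, and this holds for every fibre (\<open>countably_rectifiable_fibre\<close>).

  All other points are negligible in almost every fibre (\<open>hausdorff_null_singular_fibres\<close>). The
  reason is a comparison of volumes (\<open>hausdorff_measure_fat_fibres\<close>). Suppose that many fibres have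
  \<open>k\<close>-dimensional measure above \<open>a\<close> in a set \<open>E\<close>, and that for \<open>x\<close> in \<open>E\<close> and all small \<open>\<rho>\<close> the set of
  points within \<open>K \<rho>\<close> of \<open>x\<close> and within \<open>L \<rho>\<close> of \<open>x\<close> for \<open>D\<close> has volume at least \<open>N \<rho>\<^sup>n\<close>. Packing a
  fibre at scale \<open>K \<rho>\<close> shows that the neighbourhood of the fibre has volume at least a constant times
  \<open>(a N / K\<^sup>k) \<rho>\<^sup>m\<close>, and a Vitali selection among the values \<open>z\<close> makes these neighbourhoods disjoint, so
  that \<open>H\<^sup>m\<close> of the set of values is at most a constant times \<open>(K\<^sup>k / (a N)) |V|\<close> for every open \<open>V\<close>
  that contains \<open>E\<close>. For a null set \<open>E\<close> one lets the volume of \<open>V\<close> tend to 0. If there are \<open>k + 1\<close>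
  independent null directions, \<open>N\<close> can be taken proportional to \<open>K\<^bsup>k+1\<^esup>\<close>, and one lets \<open>K\<close> tend to
  infinity.
\<close>


section \<open>The Hausdorff outer measure\<close>

lemma hausdorff_weight_le:
  fixes S :: "'a::metric_space set"
  assumes "\<And>x y. x \<in> S \<Longrightarrow> y \<in> S \<Longrightarrow> dist x y \<le> 2 * r" and "0 < r"
  shows "hausdorff_weight (real k) S \<le> ennreal (unit_ball_vol (real k) * r ^ k)"
proof (cases "S = {} \<or> k = 0")
  case True
  then show ?thesis by (auto simp: hausdorff_weight_def)
next
  case False
  have "diameter S \<le> 2 * r"
    unfolding diameter_def using False assms(1) by (auto intro!: cSUP_least)
  moreover have "0 \<le> diameter S"
  proof (rule diameter_ge_0)
    show "bounded S" using assms(1) by (auto simp: bounded_two_points)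
  qed
  ultimately have "(diameter S / 2) powr real k \<le> r powr real k"
    by (intro powr_mono2) auto
  also have "\<dots> = r ^ k" using \<open>0 < r\<close> by (simp add: powr_realpow)
  finally show ?thesis using False
    by (auto simp: hausdorff_weight_def intro!: ennreal_leI mult_left_mono)
qed

lemma hausdorff_weight_mono:
  assumes "S \<subseteq> T" "bounded T"
  shows "hausdorff_weight (real k) S \<le> hausdorff_weight (real k) T"
proof -
  have "bounded S" using assms bounded_subset by blast
  then show ?thesis
    using assms diameter_subset[OF assms] diameter_ge_0[of S]
    by (auto simp: hausdorff_weight_def intro!: ennreal_leI mult_left_mono powr_mono2)
qed

lemma hausdorff_delta_le:
  assumes "E \<subseteq> (\<Union>i. C i)" "\<And>i. bounded (C i)" "\<And>i. diameter (C i) \<le> \<delta>"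
  shows "hausdorff_delta s \<delta> E \<le> (\<Sum>i. hausdorff_weight s (C i))"
  unfolding hausdorff_delta_def using assms by (auto intro!: INF_lower)

lemma hausdorff_delta_mono: "E \<subseteq> F \<Longrightarrow> hausdorff_delta s \<delta> E \<le> hausdorff_delta s \<delta> F"
  unfolding hausdorff_delta_def by (rule INF_superset_mono) auto

lemma hausdorff_delta_antimono: "\<delta> \<le> \<epsilon> \<Longrightarrow> hausdorff_delta s \<epsilon> E \<le> hausdorff_delta s \<delta> E"
  unfolding hausdorff_delta_def by (rule INF_superset_mono) (auto intro: order_trans)

lemma hausdorff_measure_mono: "E \<subseteq> F \<Longrightarrow> hausdorff_measure s E \<le> hausdorff_measure s F"
  unfolding hausdorff_measure_def by (intro SUP_mono) (auto intro: hausdorff_delta_mono)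

lemma hausdorff_delta_le_measure: "0 < \<delta> \<Longrightarrow> hausdorff_delta s \<delta> E \<le> hausdorff_measure s E"
  unfolding hausdorff_measure_def by (auto intro: SUP_upper)

lemma hausdorff_weight_empty [simp]: "hausdorff_weight s {} = 0"
  by (simp add: hausdorff_weight_def)

lemma hausdorff_measure_empty [simp]: "hausdorff_measure s {} = 0"
proof -
  have "hausdorff_delta s \<delta> ({}::'a set) \<le> 0" if "\<delta> > 0" for \<delta>
    using hausdorff_delta_le[of "{}" "\<lambda>i. {}" \<delta> s] that by (simp add: diameter_def)
  then show ?thesis unfolding hausdorff_measure_def
    by (intro antisym SUP_least) (auto simp: bot_ennreal)
qed

text \<open>
  Covers found by a selection argument are indexed by a countable set that may be finite or empty;
  the definition wants a sequence, which is padded here with empty sets of weight 0. Bounding the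
  finite partial sums is what the volume comparison below delivers.
\<close>

lemma hausdorff_delta_le_of_countable_cover:
  fixes C :: "'i \<Rightarrow> 'a::metric_space set"
  assumes I: "countable I" and E: "E \<subseteq> (\<Union>i\<in>I. C i)" and "0 < \<delta>"
    and C: "\<And>i. i \<in> I \<Longrightarrow> bounded (C i)" "\<And>i. i \<in> I \<Longrightarrow> diameter (C i) \<le> \<delta>"
    and B: "\<And>F. finite F \<Longrightarrow> F \<subseteq> I \<Longrightarrow> (\<Sum>i\<in>F. hausdorff_weight s (C i)) \<le> B"
  shows "hausdorff_delta s \<delta> E \<le> B"
proof -
  define J where "J = to_nat_on I ` I"
  define C' where "C' n = (if n \<in> J then C (from_nat_into I n) else {})" for n
  have inj: "inj_on (to_nat_on I) I" using I by (rule inj_on_to_nat_on)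
  have J: "n \<in> J \<Longrightarrow> from_nat_into I n \<in> I" for n
    using I by (auto simp: J_def)
  have "E \<subseteq> (\<Union>n. C' n)"
  proof
    fix x assume "x \<in> E"
    then obtain i where "i \<in> I" "x \<in> C i" using E by auto
    then have "x \<in> C' (to_nat_on I i)" using I by (auto simp: C'_def J_def)
    then show "x \<in> (\<Union>n. C' n)" by blast
  qed
  then have "hausdorff_delta s \<delta> E \<le> (\<Sum>n. hausdorff_weight s (C' n))"
    using C J \<open>0 < \<delta>\<close> by (intro hausdorff_delta_le) (auto simp: C'_def diameter_def[of "{}"])
  also have "\<dots> \<le> B"
  proof (rule suminf_le_const)
    fix N
    have inj': "inj_on (from_nat_into I) (J \<inter> {..<N})"
      unfolding J_def inj_on_def using I by auto
    have "(\<Sum>n<N. hausdorff_weight s (C' n)) = (\<Sum>n\<in>J \<inter> {..<N}. hausdorff_weight s (C (from_nat_into I n)))"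
      by (intro sum.mono_neutral_cong_right) (auto simp: C'_def)
    also have "\<dots> = (\<Sum>i\<in>from_nat_into I ` (J \<inter> {..<N}). hausdorff_weight s (C i))"
      using inj' by (simp add: sum.reindex)
    also have "\<dots> \<le> B" using J by (intro B) auto
    finally show "(\<Sum>n<N. hausdorff_weight s (C' n)) \<le> B" .
  qed auto
  finally show ?thesis .
qed

lemma hausdorff_delta_countably_subadditive:
  "hausdorff_delta s \<delta> (\<Union>i. E i) \<le> (\<Sum>i. hausdorff_delta s \<delta> (E i))"
proof (cases "(\<Sum>i. hausdorff_delta s \<delta> (E i)) = \<infinity>")
  case False
  show ?thesis
  proof (rule ennreal_le_epsilon)
    fix e :: real assume "0 < e"
    have "\<exists>C. (E i \<subseteq> (\<Union>j. C j) \<and> (\<forall>j. bounded (C j) \<and> diameter (C j) \<le> \<delta>)) \<and>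
        (\<Sum>j. hausdorff_weight s (C j)) < hausdorff_delta s \<delta> (E i) + ennreal (e * (1/2) ^ Suc i)" for i
    proof -
      have "hausdorff_delta s \<delta> (E i) < hausdorff_delta s \<delta> (E i) + ennreal (e * (1/2) ^ Suc i)"
      proof -
        have "hausdorff_delta s \<delta> (E i) \<noteq> \<infinity>"
          using False sum_le_suminf[of "\<lambda>i. hausdorff_delta s \<delta> (E i)" "{i}"]
          by (auto simp: top_unique)
        then show ?thesis using \<open>0 < e\<close>
          by (cases "hausdorff_delta s \<delta> (E i)") (auto simp flip: ennreal_plus simp: ennreal_less_iff)
      qed
      then show ?thesis
        unfolding hausdorff_delta_def INF_less_iff by auto
    qed
    then have "\<forall>i. \<exists>C. (E i \<subseteq> (\<Union>j. C j) \<and> (\<forall>j. bounded (C j) \<and> diameter (C j) \<le> \<delta>)) \<and>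
        (\<Sum>j. hausdorff_weight s (C j)) < hausdorff_delta s \<delta> (E i) + ennreal (e * (1/2) ^ Suc i)" by (rule allI)
    from choice[OF this] obtain C where C0: "\<forall>i. (E i \<subseteq> (\<Union>j. C i j) \<and> (\<forall>j. bounded (C i j) \<and> diameter (C i j) \<le> \<delta>)) \<and>
      (\<Sum>j. hausdorff_weight s (C i j)) < hausdorff_delta s \<delta> (E i) + ennreal (e * (1/2) ^ Suc i)" ..
    then have C: "\<And>i. E i \<subseteq> (\<Union>j. C i j)" "\<And>i j. bounded (C i j)" "\<And>i j. diameter (C i j) \<le> \<delta>"
      "\<And>i. (\<Sum>j. hausdorff_weight s (C i j)) < hausdorff_delta s \<delta> (E i) + ennreal (e * (1/2) ^ Suc i)"
      by blast+
    have "hausdorff_delta s \<delta> (\<Union>i. E i) \<le> (\<Sum>n. hausdorff_weight s (case prod_decode n of (i,j) \<Rightarrow> C i j))"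
    proof (rule hausdorff_delta_le)
      show "(\<Union>i. E i) \<subseteq> (\<Union>n. case prod_decode n of (i,j) \<Rightarrow> C i j)"
      proof
        fix x assume "x \<in> (\<Union>i. E i)"
        then obtain i j where "x \<in> C i j" using C(1) by blast
        then show "x \<in> (\<Union>n. case prod_decode n of (i,j) \<Rightarrow> C i j)"
          by (intro UN_I[of "prod_encode (i,j)"]) simp_all
      qed
    qed (auto simp: C split: prod.splits)
    also have "\<dots> = (\<Sum>n. (\<lambda>(i,j). hausdorff_weight s (C i j)) (prod_decode n))"
      by (simp add: case_prod_unfold)
    also have "\<dots> = (\<Sum>i. \<Sum>j. hausdorff_weight s (C i j))"
      by (rule suminf_ennreal_2dimen) simp
    also have "\<dots> \<le> (\<Sum>i. hausdorff_delta s \<delta> (E i) + ennreal (e * (1/2) ^ Suc i))"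
      using C(4) by (intro suminf_le) (auto intro: less_imp_le)
    also have "\<dots> = (\<Sum>i. hausdorff_delta s \<delta> (E i)) + (\<Sum>i. ennreal (e * (1/2) ^ Suc i))"
      by (rule suminf_add[symmetric]) auto
    also have "(\<Sum>i. ennreal (e * (1/2) ^ Suc i)) = ennreal e"
      using sums_mult[OF power_half_series, of e] \<open>0 < e\<close>
      by (subst suminf_ennreal_eq[of _ e]) auto
    finally show "hausdorff_delta s \<delta> (\<Union>i. E i) \<le> (\<Sum>i. hausdorff_delta s \<delta> (E i)) + ennreal e" .
  qed
qed simp

lemma hausdorff_measure_countably_subadditive:
  "hausdorff_measure s (\<Union>i. E i) \<le> (\<Sum>i. hausdorff_measure s (E i))"
proof (subst hausdorff_measure_def, rule SUP_least)
  fix \<delta> :: real assume "\<delta> \<in> {0<..}"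
  then have "(\<Sum>i. hausdorff_delta s \<delta> (E i)) \<le> (\<Sum>i. hausdorff_measure s (E i))"
    by (intro suminf_le) (auto intro: hausdorff_delta_le_measure)
  then show "hausdorff_delta s \<delta> (\<Union>i. E i) \<le> (\<Sum>i. hausdorff_measure s (E i))"
    by (rule order_trans[OF hausdorff_delta_countably_subadditive])
qed

lemma hausdorff_measure_Un: "hausdorff_measure s (E \<union> F) \<le> hausdorff_measure s E + hausdorff_measure s F"
proof -
  define G where "G i = (if i = 0 then E else if i = 1 then F else {})" for i :: nat
  have "E = G 0" "F = G 1" by (auto simp: G_def)
  then have "E \<union> F \<subseteq> (\<Union>i. G i)" by blast
  then have "hausdorff_measure s (E \<union> F) \<le> (\<Sum>i. hausdorff_measure s (G i))"
    by (rule order_trans[OF hausdorff_measure_mono hausdorff_measure_countably_subadditive])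
  also have "\<dots> = hausdorff_measure s E + hausdorff_measure s F"
    by (subst suminf_finite[of "{0,1}"]) (auto simp: G_def)
  finally show ?thesis .
qed

lemma hausdorff_measure_null_UN:
  assumes "\<And>i::nat. hausdorff_measure s (E i) = 0"
  shows "hausdorff_measure s (\<Union>i. E i) = 0"
  using hausdorff_measure_countably_subadditive[of s E] assms by simp

lemma hausdorff_measure_null_subset:
  "hausdorff_measure s F = 0 \<Longrightarrow> E \<subseteq> F \<Longrightarrow> hausdorff_measure s E = 0"
  using hausdorff_measure_mono[of E F s] by simp

text \<open>
  For covers of mesh below the distance of the two sets, no covering set meets both.
\<close>

lemma hausdorff_measure_metric_additive:
  assumes d: "0 < d" and sep: "\<And>x y. x \<in> E \<Longrightarrow> y \<in> F \<Longrightarrow> d \<le> dist x y"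
  shows "hausdorff_measure (real k) (E \<union> F) \<ge> hausdorff_measure (real k) E + hausdorff_measure (real k) F"
proof -
  have small: "hausdorff_delta (real k) \<delta> E + hausdorff_delta (real k) \<delta> F
      \<le> hausdorff_measure (real k) (E \<union> F)" if "0 < \<delta>" "\<delta> < d" for \<delta>
  proof -
    have "hausdorff_delta (real k) \<delta> E + hausdorff_delta (real k) \<delta> F \<le> hausdorff_delta (real k) \<delta> (E \<union> F)"
      unfolding hausdorff_delta_def[of _ _ "E \<union> F"]
    proof (rule INF_greatest, clarify)
      fix C :: "nat \<Rightarrow> 'a set"
      assume cov: "E \<union> F \<subseteq> (\<Union>i. C i)" and C: "\<forall>i. bounded (C i) \<and> diameter (C i) \<le> \<delta>"
      have disj: "C i \<inter> E = {} \<or> C i \<inter> F = {}" for i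
      proof (rule ccontr)
        assume "\<not> ?thesis"
        then obtain x y where xy: "x \<in> C i" "x \<in> E" "y \<in> C i" "y \<in> F" by auto
        then have "dist x y \<le> \<delta>"
          using C diameter_bounded_bound[of "C i" x y] by (meson order_trans)
        then show False using sep xy that by fastforce
      qed
      have bd: "bounded (C i \<inter> G)" "diameter (C i \<inter> G) \<le> \<delta>" for i G
        using C diameter_subset[of "C i \<inter> G" "C i"] by (auto intro: bounded_Int order_trans)
      have "hausdorff_delta (real k) \<delta> G \<le> (\<Sum>i. hausdorff_weight (real k) (C i \<inter> G))"
        if "G \<subseteq> E \<union> F" for G
        using that cov bd by (intro hausdorff_delta_le) auto
      then have "hausdorff_delta (real k) \<delta> E + hausdorff_delta (real k) \<delta> F
          \<le> (\<Sum>i. hausdorff_weight (real k) (C i \<inter> E)) + (\<Sum>i. hausdorff_weight (real k) (C i \<inter> F))"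
        by (intro add_mono) auto
      also have "\<dots> = (\<Sum>i. hausdorff_weight (real k) (C i \<inter> E) + hausdorff_weight (real k) (C i \<inter> F))"
        by (rule suminf_add) auto
      also have "\<dots> \<le> (\<Sum>i. hausdorff_weight (real k) (C i))"
      proof (rule suminf_le)
        fix i
        show "hausdorff_weight (real k) (C i \<inter> E) + hausdorff_weight (real k) (C i \<inter> F)
            \<le> hausdorff_weight (real k) (C i)"
          using disj[of i] C hausdorff_weight_mono[of "C i \<inter> E" "C i" k] hausdorff_weight_mono[of "C i \<inter> F" "C i" k]
          by auto
      qed auto
      finally show "hausdorff_delta (real k) \<delta> E + hausdorff_delta (real k) \<delta> F
          \<le> (\<Sum>i. hausdorff_weight (real k) (C i))" .
    qed
    then show ?thesis by (rule order_trans[OF _ hausdorff_delta_le_measure[OF that(1)]])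
  qed
  have "hausdorff_delta (real k) \<delta> E + hausdorff_delta (real k) \<epsilon> F \<le> hausdorff_measure (real k) (E \<union> F)"
    if "0 < \<delta>" "0 < \<epsilon>" for \<delta> \<epsilon>
  proof -
    let ?\<eta> = "min (d/2) (min \<delta> \<epsilon>)"
    have "hausdorff_delta (real k) \<delta> E + hausdorff_delta (real k) \<epsilon> F
        \<le> hausdorff_delta (real k) ?\<eta> E + hausdorff_delta (real k) ?\<eta> F"
      by (intro add_mono hausdorff_delta_antimono) auto
    also have "\<dots> \<le> hausdorff_measure (real k) (E \<union> F)" using that d by (intro small) auto
    finally show ?thesis .
  qed
  then have "(SUP \<delta>\<in>{0<..}. hausdorff_delta (real k) \<delta> E) + (SUP \<epsilon>\<in>{0<..}. hausdorff_delta (real k) \<epsilon> F)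
      \<le> hausdorff_measure (real k) (E \<union> F)"
    by (simp add: ennreal_SUP_add_left[symmetric] ennreal_SUP_add_right SUP_le_iff)
  then show ?thesis by (simp add: hausdorff_measure_def)
qed

lemma ennreal_suminf_tail_less:
  fixes g :: "nat \<Rightarrow> ennreal"
  assumes "(\<Sum>i. g i) < \<infinity>" "0 < e"
  shows "\<exists>n. (\<Sum>i. g (i + n)) \<le> e"
proof -
  let ?S = "\<Sum>i. g i"
  show ?thesis
  proof (cases "?S \<le> e")
    case True
    then show ?thesis by (intro exI[of _ 0]) simp
  next
    case False
    then have "?S - e < ?S"
      using assms by (intro ennreal_between) (auto simp: top_unique)
    then obtain n where n: "?S - e < (\<Sum>i<n. g i)"
      by (auto simp: suminf_eq_SUP less_SUP_iff)
    have split: "?S = (\<Sum>i. g (i + n)) + (\<Sum>i<n. g i)"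
      by (rule suminf_offset) auto
    have "?S \<le> e + (\<Sum>i<n. g i)"
      using n by (metis add.commute ennreal_minus_le_iff infinity_ennreal_def less_imp_le)
    moreover have "(\<Sum>i<n. g i) < \<infinity>"
      using split assms(1) by (metis ennreal_add_eq_top infinity_ennreal_def less_top)
    ultimately have "(\<Sum>i. g (i + n)) \<le> e"
      unfolding split by (metis add.commute ennreal_add_left_cancel_le infinity_ennreal_def less_irrefl)
    then show ?thesis ..
  qed
qed

text \<open>
  Caratheodory's lemma. The rings \<open>T (i + 1) - T i\<close> of equal parity are pairwise at positive distance,
  so their measures sum up to at most the supremum; hence the sum over all rings converges, and
  \<open>T n\<close> together with the rings beyond \<open>n\<close> covers the union.
\<close>

lemma hausdorff_measure_le_SUP_of_gaps:
  fixes T :: "nat \<Rightarrow> 'a::metric_space set"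
  assumes inc: "\<And>i. T i \<subseteq> T (Suc i)"
    and gap: "\<And>i. \<exists>d>0. \<forall>x\<in>T i. \<forall>y\<in>(\<Union>j. T j) - T (Suc i). d \<le> dist x y"
  shows "hausdorff_measure (real k) (\<Union>i. T i) \<le> (SUP i. hausdorff_measure (real k) (T i))"
    (is "?H (\<Union>i. T i) \<le> ?M")
proof (rule ennreal_le_epsilon)
  fix e :: real assume fin: "?M < top" and "0 < e"
  define R where "R i = T (Suc i) - T i" for i
  have mono: "i \<le> j \<Longrightarrow> T i \<subseteq> T j" for i j
    by (rule lift_Suc_mono_le[of T]) (use inc in auto)
  have M: "?H (T i) \<le> ?M" for i by (rule SUP_upper) simp
  have part: "(\<Sum>j<Suc n. ?H (R (2 * j + p))) \<le> ?H (T (2 * n + p + 1))" for n p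
  proof (induction n)
    case 0
    then show ?case by (auto simp: R_def intro!: hausdorff_measure_mono)
  next
    case (Suc n)
    obtain d where "d > 0" and d: "\<forall>x\<in>T (2 * n + p + 1). \<forall>y\<in>(\<Union>j. T j) - T (2 * n + p + 2). d \<le> dist x y"
      using gap[of "2 * n + p + 1"] by auto
    have "(\<Sum>j<Suc (Suc n). ?H (R (2 * j + p))) \<le> ?H (T (2 * n + p + 1)) + ?H (R (2 * Suc n + p))"
      using Suc.IH by (simp add: add_right_mono)
    also have "\<dots> \<le> ?H (T (2 * n + p + 1) \<union> R (2 * Suc n + p))"
      by (rule hausdorff_measure_metric_additive[OF \<open>d > 0\<close>]) (use d in \<open>auto simp: R_def\<close>)
    also have "\<dots> \<le> ?H (T (2 * Suc n + p + 1))"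
      using mono[of "2 * n + p + 1" "2 * Suc n + p + 1"]
      by (intro hausdorff_measure_mono) (auto simp: R_def)
    finally show ?case .
  qed
  have "(\<Sum>i. ?H (R i)) \<le> ?M + ?M"
  proof (rule suminf_le_const)
    fix N
    have eq: "(\<Sum>i<2 * n. ?H (R i)) = (\<Sum>j<n. ?H (R (2 * j + 0))) + (\<Sum>j<n. ?H (R (2 * j + 1)))" for n
      by (induction n) (auto simp: algebra_simps)
    have "(\<Sum>i<N. ?H (R i)) \<le> (\<Sum>i<2 * Suc N. ?H (R i))"
      by (rule sum_mono2) auto
    also have "\<dots> \<le> ?M + ?M"
      unfolding eq by (intro add_mono order_trans[OF part M])
    finally show "(\<Sum>i<N. ?H (R i)) \<le> ?M + ?M" .
  qed auto
  also have "\<dots> < \<infinity>" using fin by simp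
  finally obtain n where n: "(\<Sum>i. ?H (R (i + n))) \<le> ennreal e"
    using ennreal_suminf_tail_less[of "\<lambda>i. ?H (R i)" "ennreal e"] \<open>0 < e\<close> by auto
  have "x \<in> T n \<union> (\<Union>i. R (i + n))" if "x \<in> T j" for x j
  proof (cases "j \<le> n")
    case True
    then show ?thesis using mono that by auto
  next
    case False
    then show ?thesis using that
    proof (induction j)
      case (Suc j)
      show ?case
      proof (cases "x \<in> T j")
        case True
        then show ?thesis using Suc mono[of j n] by (cases "j \<le> n") auto
      next
        case False
        then have "x \<in> R ((j - n) + n)" using Suc by (auto simp: R_def)
        then show ?thesis by blast
      qed
    qed simp
  qed
  then have "?H (\<Union>i. T i) \<le> ?H (T n \<union> (\<Union>i. R (i + n)))"
    by (intro hausdorff_measure_mono) auto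
  also have "\<dots> \<le> ?H (T n) + ?H (\<Union>i. R (i + n))" by (rule hausdorff_measure_Un)
  also have "\<dots> \<le> ?M + ennreal e"
    using hausdorff_measure_countably_subadditive[of "real k" "\<lambda>i. R (i + n)"] n
    by (intro add_mono M) (rule order_trans)
  finally show "?H (\<Union>i. T i) \<le> ?M + ennreal e" .
qed

text \<open>
  Caratheodory's criterion for closed sets: \<open>S - C\<close> is exhausted by the points of \<open>S\<close> at distance at
  least \<open>1 / (i + 1)\<close> from \<open>C\<close>, each of these sets is at positive distance from \<open>S \<inter> C\<close>, and the previous lemma
  allows passing to the limit.
\<close>

lemma hausdorff_measure_closed_split:
  fixes C :: "'a::metric_space set"
  assumes "closed C"
  shows "hausdorff_measure (real k) (S \<inter> C) + hausdorff_measure (real k) (S - C) = hausdorff_measure (real k) S"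
    (is "_ = ?H S")
proof (rule antisym)
  show "?H (S \<inter> C) + ?H (S - C) \<le> ?H S"
  proof (cases "C = {}")
    case False
    define T where "T i = {x \<in> S - C. 1 / real (Suc i) \<le> infdist x C}" for i
    have anti: "1 / real (Suc (Suc i)) < 1 / real (Suc i)" for i by (simp add: field_simps)
    have "S - C \<subseteq> (\<Union>i. T i)"
    proof
      fix x assume x: "x \<in> S - C"
      then have "0 < infdist x C" using assms False by (simp add: infdist_pos_not_in_closed)
      then obtain i where "1 / real (Suc i) < infdist x C" using reals_Archimedean by (auto simp: inverse_eq_divide)
      then show "x \<in> (\<Union>i. T i)" using x by (auto simp: T_def intro!: exI[of _ i])
    qed
    then have "?H (S - C) \<le> ?H (\<Union>i. T i)" by (rule hausdorff_measure_mono)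
    also have "\<dots> \<le> (SUP i. ?H (T i))"
    proof (rule hausdorff_measure_le_SUP_of_gaps)
      show "T i \<subseteq> T (Suc i)" for i using anti[of i] by (auto simp: T_def)
      show "\<exists>d>0. \<forall>x\<in>T i. \<forall>y\<in>(\<Union>j. T j) - T (Suc i). d \<le> dist x y" for i
      proof (intro exI conjI ballI)
        show "0 < 1 / real (Suc i) - 1 / real (Suc (Suc i))" using anti[of i] by simp
        fix x y assume "x \<in> T i" "y \<in> (\<Union>j. T j) - T (Suc i)"
        then show "1 / real (Suc i) - 1 / real (Suc (Suc i)) \<le> dist x y"
          using infdist_triangle[of x C y] by (auto simp: T_def)
      qed
    qed
    finally have "?H (S \<inter> C) + ?H (S - C) \<le> ?H (S \<inter> C) + (SUP i. ?H (T i))"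
      by (rule add_left_mono)
    also have "\<dots> = (SUP i. ?H (S \<inter> C) + ?H (T i))" by (rule ennreal_SUP_add_right) simp
    also have "\<dots> \<le> ?H S"
    proof (rule SUP_least)
      fix i
      have "?H (S \<inter> C) + ?H (T i) \<le> ?H (S \<inter> C \<union> T i)"
      proof (rule hausdorff_measure_metric_additive[of "1 / real (Suc i)"])
        fix x y assume "x \<in> S \<inter> C" "y \<in> T i"
        then show "1 / real (Suc i) \<le> dist x y"
          using infdist_le[of x C y] by (auto simp: T_def dist_commute)
      qed simp
      also have "\<dots> \<le> ?H S" by (rule hausdorff_measure_mono) (auto simp: T_def)
      finally show "?H (S \<inter> C) + ?H (T i) \<le> ?H S" .
    qed
    finally show ?thesis .
  qed simp
  show "?H S \<le> ?H (S \<inter> C) + ?H (S - C)"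
    using hausdorff_measure_Un[of "real k" "S \<inter> C" "S - C"] by (simp add: Int_Diff_Un)
qed

text \<open>
  Continuity from below for an arbitrary set \<open>S\<close>: the function \<open>B \<mapsto> H (S \<inter> B)\<close> is again an outer
  measure for which closed sets are measurable. It is used to pass from a property holding at all
  sufficiently small scales, with a threshold depending on the point, to a uniform threshold on a
  part of a fibre that still has large measure.
\<close>

lemma hausdorff_measure_closed_exhaustion:
  fixes S :: "'a::metric_space set"
  assumes cl: "\<And>i. closed (C i)" and inc: "incseq C" and S: "S \<subseteq> (\<Union>i. C i)"
    and a: "a < hausdorff_measure (real k) S"
  shows "\<exists>i. a < hausdorff_measure (real k) (S \<inter> C i)"
proof -
  let ?f = "\<lambda>B. hausdorff_measure (real k) (S \<inter> B)"
  let ?L = "lambda_system UNIV (Pow UNIV) ?f"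
  have oms: "outer_measure_space (Pow UNIV) ?f"
    unfolding outer_measure_space_def
  proof (intro conjI)
    show "positive (Pow UNIV) ?f" by (simp add: positive_def)
    show "increasing (Pow UNIV) ?f" by (auto simp: increasing_def intro!: hausdorff_measure_mono)
    show "countably_subadditive (Pow UNIV) ?f"
      using hausdorff_measure_countably_subadditive[of "real k"]
      by (auto simp: countably_subadditive_def Int_UN_distrib simp del: UN_simps)
  qed
  interpret P: sigma_algebra UNIV "Pow UNIV" by (rule sigma_algebra_Pow)
  have ms: "measure_space UNIV ?L ?f" using P.caratheodory_lemma[OF oms] .
  then interpret L: sigma_algebra UNIV ?L by (simp add: measure_space_def)
  have C: "C i \<in> ?L" for i
    unfolding P.lambda_system_eq
    using hausdorff_measure_closed_split[OF cl[of i], of k "S \<inter> X" for X]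
    by (auto simp: Int_assoc Int_Diff)
  have "(\<Union>i. C i) \<in> ?L" using C by (intro L.countable_UN) auto
  then have "(\<lambda>i. ?f (C i)) \<longlonglongrightarrow> ?f (\<Union>i. C i)"
    using ms C inc unfolding measure_space_def
    using L.countably_additive_iff_continuous_from_below[of ?f] L.countably_additive_additive[of ?f]
    by (auto simp: image_subset_iff)
  moreover have "?f (\<Union>i. C i) = hausdorff_measure (real k) S" using S by (simp add: Int_absorb2)
  ultimately have "\<forall>\<^sub>F i in sequentially. a < ?f (C i)" using a by (simp add: order_tendstoD)
  then show ?thesis by (auto simp: eventually_sequentially)
qed

section \<open>Negligible sets and density\<close>

text \<open>
  Choose, by Vitali's theorem, disjoint balls inside \<open>T\<close> in each of which \<open>Q\<close> is covered by a fraction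
  \<open>c\<close> of the volume; these covers together with a null set replace \<open>T\<close>.
\<close>

lemma open_cover_shrink:
  fixes Q :: "'a::euclidean_space set"
  assumes c: "0 \<le> c" "c < 1"
    and dens: "\<And>x r. x \<in> Q \<Longrightarrow> 0 < r \<Longrightarrow> \<exists>d U. 0 < d \<and> d \<le> r \<and> Q \<inter> ball x d \<subseteq> U \<and>
      U \<in> lmeasurable \<and> measure lebesgue U \<le> c * measure lebesgue (ball x d)"
    and T: "open T" "T \<in> lmeasurable" "Q \<subseteq> T" and "0 < e"
  shows "\<exists>T'. open T' \<and> T' \<in> lmeasurable \<and> Q \<subseteq> T' \<and> measure lebesgue T' \<le> c * measure lebesgue T + e"
proof -
  define good where "good x d U \<longleftrightarrow> 0 < d \<and> ball x d \<subseteq> T \<and> Q \<inter> ball x d \<subseteq> U \<and>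
      U \<in> lmeasurable \<and> measure lebesgue U \<le> c * measure lebesgue (ball x d)" for x d U
  define K where "K = {(x,d,U). x \<in> Q \<and> good x d U}"
  obtain C where C: "countable C" "C \<subseteq> K"
    and disj: "pairwise (\<lambda>i j. disjnt (ball (fst i) (fst (snd i))) (ball (fst j) (fst (snd j)))) C"
    and neg: "negligible (Q - (\<Union>i\<in>C. ball (fst i) (fst (snd i))))"
  proof (rule Vitali_covering_theorem_balls[of Q K fst "\<lambda>i. fst (snd i)"])
    fix x and r :: real assume "x \<in> Q" "0 < r"
    obtain s where "s > 0" "ball x s \<subseteq> T" using T \<open>x \<in> Q\<close> by (meson openE subsetD)
    obtain d U where d: "0 < d" "d \<le> min s (r/2)" and U: "Q \<inter> ball x d \<subseteq> U"
      "U \<in> lmeasurable" "measure lebesgue U \<le> c * measure lebesgue (ball x d)"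
      using dens[OF \<open>x \<in> Q\<close>, of "min s (r/2)"] \<open>0 < r\<close> \<open>s > 0\<close> by auto
    have "ball x d \<subseteq> T" using d \<open>ball x s \<subseteq> T\<close> by (auto intro: subset_ball[THEN subsetD])
    then have "(x,d,U) \<in> K" using d U \<open>x \<in> Q\<close> by (auto simp: K_def good_def)
    then show "\<exists>i. i \<in> K \<and> x \<in> ball (fst i) (fst (snd i)) \<and> fst (snd i) < r"
      using d \<open>0 < r\<close> by (intro exI[of _ "(x,d,U)"]) auto
  qed blast
  let ?B = "\<lambda>i. ball (fst i) (fst (snd i))" and ?U = "\<lambda>i. snd (snd i)"
  have CK: "?B i \<subseteq> T" "Q \<inter> ?B i \<subseteq> ?U i" "?U i \<in> lmeasurable"
      "measure lebesgue (?U i) \<le> c * measure lebesgue (?B i)" if "i \<in> C" for i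
  proof -
    have "good (fst i) (fst (snd i)) (snd (snd i))" using that C(2) by (auto simp: K_def)
    then show "?B i \<subseteq> T" "Q \<inter> ?B i \<subseteq> ?U i" "?U i \<in> lmeasurable"
      "measure lebesgue (?U i) \<le> c * measure lebesgue (?B i)" unfolding good_def by blast+
  qed
  have fin: "measure lebesgue (\<Union>i\<in>I. ?U i) \<le> c * measure lebesgue T" if "I \<subseteq> C" "finite I" for I
  proof -
    have "measure lebesgue (\<Union>i\<in>I. ?U i) \<le> (\<Sum>i\<in>I. measure lebesgue (?U i))"
      using that CK by (intro measure_UNION_le) auto
    also have "\<dots> \<le> (\<Sum>i\<in>I. c * measure lebesgue (?B i))"
      using that CK by (intro sum_mono) auto
    also have "\<dots> = c * measure lebesgue (\<Union>i\<in>I. ?B i)"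
    proof -
      have "measure lebesgue (\<Union>i\<in>I. ?B i) = (\<Sum>i\<in>I. measure lebesgue (?B i))"
        using that by (intro measure_UNION' pairwise_subset[OF disj]) auto
      then show ?thesis by (simp only: sum_distrib_left)
    qed
    also have "\<dots> \<le> c * measure lebesgue T"
    proof (intro mult_left_mono measure_mono_fmeasurable)
      show "(\<Union>i\<in>I. ?B i) \<subseteq> T" using CK(1) \<open>I \<subseteq> C\<close> by blast
    qed (use that T c in auto)
    finally show ?thesis .
  qed
  define W where "W = (\<Union>i\<in>C. ?U i) \<union> (Q - (\<Union>i\<in>C. ?B i))"
  have U: "(\<Union>i\<in>C. ?U i) \<in> lmeasurable"
    by (rule fmeasurable_UN_bound[OF C(1) CK(3) fin])
  have muU: "measure lebesgue (\<Union>i\<in>C. ?U i) \<le> c * measure lebesgue T"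
    by (rule measure_UN_bound[OF C(1) CK(3) fin])
  have null: "Q - (\<Union>i\<in>C. ?B i) \<in> null_sets lebesgue" using neg by (simp only: negligible_iff_null_sets)
  have W: "W \<in> lmeasurable"
    unfolding W_def by (intro fmeasurable.Un U fmeasurableI_null_sets null)
  have muW: "measure lebesgue W \<le> c * measure lebesgue T"
    unfolding W_def using muU by (subst measure_Un_null_set[OF fmeasurableD[OF U] null])
  obtain T' where T': "open T'" "W \<subseteq> T'" "T' - W \<in> lmeasurable" "emeasure lebesgue (T' - W) < ennreal e"
    using sets_lebesgue_outer_open[OF fmeasurableD[OF W] \<open>0 < e\<close>] .
  have eq: "T' = W \<union> (T' - W)" using T' by auto
  have "measure lebesgue (T' - W) \<le> e"
    using T'(3,4) \<open>0 < e\<close> by (simp add: emeasure_eq_measure2 ennreal_less_iff)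
  moreover have "measure lebesgue T' \<le> measure lebesgue W + measure lebesgue (T' - W)"
    using T' W by (subst eq, intro measure_Un_le) auto
  moreover have "T' \<in> lmeasurable" using T' W by (subst eq, intro fmeasurable.Un) auto
  moreover have "Q \<subseteq> W" using CK(2) unfolding W_def by blast
  ultimately show ?thesis using T'(1,2) muW by (intro exI[of _ T']) auto
qed

text \<open>
  A form of Lebesgue's density theorem: at almost every point of a set its lower outer density is 1.
  For a bounded part of \<open>P\<close> the infimum \<open>M\<close> of the volumes of open supersets satisfies \<open>M \<le> c M\<close> by the
  previous lemma.
\<close>

lemma negligible_of_partial_density:
  fixes P :: "'a::euclidean_space set"
  assumes c: "0 \<le> c" "c < 1"
    and dens: "\<And>x r. x \<in> P \<Longrightarrow> 0 < r \<Longrightarrow> \<exists>d U. 0 < d \<and> d \<le> r \<and> P \<inter> ball x d \<subseteq> U \<and>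
      U \<in> lmeasurable \<and> measure lebesgue U \<le> c * measure lebesgue (ball x d)"
  shows "negligible P"
proof -
  have "negligible (P \<inter> ball 0 (real k))" for k
  proof -
    let ?Q = "P \<inter> ball 0 (real k)"
    define M where "M = measure lebesgue ` {T. open T \<and> T \<in> lmeasurable \<and> ?Q \<subseteq> T}"
    have ne: "measure lebesgue (ball (0::'a) (real k)) \<in> M"
      unfolding M_def by (rule imageI) auto
    have bdd: "bdd_below M" by (auto simp: M_def intro!: bdd_belowI[of _ 0])
    have "M \<noteq> {}" using ne by blast
    then have "0 \<le> Inf M" by (rule cInf_greatest) (auto simp: M_def)
    have shrink: "\<exists>t'\<in>M. t' \<le> c * t + e" if t: "t \<in> M" and "0 < e" for t e
    proof -
      obtain T where T: "open T" "T \<in> lmeasurable" "?Q \<subseteq> T" "t = measure lebesgue T"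
        using t by (auto simp: M_def)
      have "\<exists>d U. 0 < d \<and> d \<le> r \<and> ?Q \<inter> ball x d \<subseteq> U \<and>
          U \<in> lmeasurable \<and> measure lebesgue U \<le> c * measure lebesgue (ball x d)"
        if "x \<in> ?Q" "0 < r" for x r
      proof -
        obtain d U where "0 < d" "d \<le> r" "P \<inter> ball x d \<subseteq> U"
          "U \<in> lmeasurable" "measure lebesgue U \<le> c * measure lebesgue (ball x d)"
          using dens[of x r] \<open>x \<in> ?Q\<close> \<open>0 < r\<close> by blast
        then show ?thesis by (intro exI[of _ d] exI[of _ U]) auto
      qed
      from open_cover_shrink[OF c this T(1-3) \<open>0 < e\<close>] obtain T' where "open T'"
        "T' \<in> lmeasurable" "?Q \<subseteq> T'" "measure lebesgue T' \<le> c * measure lebesgue T + e" by blast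
      then show ?thesis using T by (intro bexI[of _ "measure lebesgue T'"]) (auto simp: M_def)
    qed
    have "Inf M \<le> c * Inf M + e" if "0 < e" for e
    proof -
      obtain t where t: "t \<in> M" "t < Inf M + e / 2"
        using \<open>M \<noteq> {}\<close> bdd \<open>0 < e\<close> cInf_lessD[of M "Inf M + e/2"] by auto
      obtain t' where "t' \<in> M" "t' \<le> c * t + e / 2" using shrink[OF t(1), of "e/2"] \<open>0 < e\<close> by auto
      then have "Inf M \<le> c * t + e / 2" using bdd by (meson cInf_lower order_trans)
      moreover have "c * t \<le> c * (Inf M + e / 2)" using t c by (intro mult_left_mono) auto
      moreover have "c * (e / 2) \<le> e / 2" using c \<open>0 < e\<close> by (simp add: mult_left_le_one_le)
      moreover have "c * (Inf M + e / 2) = c * Inf M + c * (e / 2)" by (rule distrib_left)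
      ultimately show ?thesis by linarith
    qed
    then have "Inf M \<le> c * Inf M" by (rule field_le_epsilon)
    then have "(1 - c) * Inf M \<le> 0" by (simp add: left_diff_distrib)
    then have "Inf M = 0" using \<open>0 \<le> Inf M\<close> c by (simp add: mult_le_0_iff)
    show ?thesis
      unfolding negligible_outer
    proof (intro allI impI)
      fix e :: real assume "0 < e"
      then obtain t where "t \<in> M" "t < e" using \<open>M \<noteq> {}\<close> bdd \<open>Inf M = 0\<close> cInf_lessD[of M e] by auto
      then show "\<exists>T. ?Q \<subseteq> T \<and> T \<in> lmeasurable \<and> measure lebesgue T < e" by (auto simp: M_def)
    qed
  qed
  then have "negligible (\<Union>(range (\<lambda>k. P \<inter> ball 0 (real k))))"
    by (subst negligible_iff_null_sets, intro null_sets_UN) (simp add: negligible_iff_null_sets)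
  moreover have "P \<subseteq> (\<Union>k. P \<inter> ball 0 (real k))"
  proof
    fix x assume "x \<in> P"
    obtain k where "norm x < real k" using reals_Archimedean2 by blast
    then show "x \<in> (\<Union>k. P \<inter> ball 0 (real k))" using \<open>x \<in> P\<close> by (intro UN_I[of k]) auto
  qed
  ultimately show ?thesis by (rule negligible_subset)
qed

text \<open>
  Near almost every point \<open>x\<close> of a set \<open>S\<close>, every point \<open>x + w\<close> is within \<open>\<eta> |w|\<close> of \<open>S\<close>: the missing ball
  would take a fixed fraction out of the ball of radius \<open>2 |w|\<close> around \<open>x\<close>.
\<close>

lemma negligible_porous:
  fixes S :: "'a::euclidean_space set"
  assumes \<eta>: "0 < \<eta>" "\<eta> \<le> 1"
  shows "negligible {x \<in> S. \<forall>r>0. \<exists>w. w \<noteq> 0 \<and> norm w < r \<and> ball (x + w) (\<eta> * norm w) \<inter> S = {}}"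
    (is "negligible ?P")
proof (rule negligible_of_partial_density)
  let ?n = "DIM('a)"
  have "0 \<le> \<eta> / 2" "\<eta> / 2 \<le> 1" using \<eta> by simp_all
  then have "(\<eta> / 2) ^ ?n \<le> 1" by (rule power_le_one)
  then show "0 \<le> 1 - (\<eta> / 2) ^ ?n" by simp
  have "0 < (\<eta> / 2) ^ ?n" using \<eta>(1) by (intro zero_less_power) simp
  then show "1 - (\<eta> / 2) ^ ?n < 1" by simp
  fix x and r :: real assume "x \<in> ?P" "0 < r"
  then have "\<forall>r>0. \<exists>w. w \<noteq> 0 \<and> norm w < r \<and> ball (x + w) (\<eta> * norm w) \<inter> S = {}" by blast
  moreover have "0 < r / 2" using \<open>0 < r\<close> by simp
  ultimately obtain w where w: "w \<noteq> 0" "norm w < r / 2" "ball (x + w) (\<eta> * norm w) \<inter> S = {}" by blast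
  let ?d = "2 * norm w" and ?V = "ball (x + w) (\<eta> * norm w)"
  have sub: "?V \<subseteq> ball x ?d"
  proof
    fix y assume "y \<in> ?V"
    moreover have "\<eta> * norm w \<le> norm w" using \<eta> by (simp add: mult_left_le_one_le)
    ultimately have "dist (x + w) y < norm w" by simp
    moreover have "dist x y \<le> dist x (x + w) + dist (x + w) y" by (rule dist_triangle)
    ultimately show "y \<in> ball x ?d" by (simp add: dist_norm)
  qed
  have "measure lebesgue (ball x ?d - ?V) = measure lebesgue (ball x ?d) - measure lebesgue ?V"
    using sub by (intro measurable_measure_Diff) auto
  also have "measure lebesgue ?V = (\<eta> / 2) ^ ?n * measure lebesgue (ball x ?d)"
  proof -
    have "\<eta> * norm w = (\<eta> / 2) * ?d" by simp
    then have "(\<eta> * norm w) ^ ?n = (\<eta> / 2) ^ ?n * ?d ^ ?n" by (simp only: power_mult_distrib)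
    moreover have "measure lebesgue ?V = (\<eta> * norm w) ^ ?n * measure lebesgue (ball (0::'a) 1)"
      using \<eta> content_ball_conv_unit_ball[of "\<eta> * norm w" "x + w"] by simp
    moreover have "measure lebesgue (ball x ?d) = ?d ^ ?n * measure lebesgue (ball (0::'a) 1)"
      using content_ball_conv_unit_ball[of ?d x] by simp
    ultimately show ?thesis by (simp only: mult.assoc)
  qed
  finally have "measure lebesgue (ball x ?d - ?V) = (1 - (\<eta> / 2) ^ ?n) * measure lebesgue (ball x ?d)"
    by (simp add: left_diff_distrib)
  moreover have "?P \<inter> ball x ?d \<subseteq> ball x ?d - ?V" using w(3) by blast
  moreover have "0 < ?d" "?d \<le> r" using w(1,2) by auto
  moreover have "ball x ?d - ?V \<in> lmeasurable" by (intro fmeasurable_Diff) auto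
  ultimately show "\<exists>d U. 0 < d \<and> d \<le> r \<and> ?P \<inter> ball x d \<subseteq> U \<and> U \<in> lmeasurable \<and>
      measure lebesgue U \<le> (1 - (\<eta> / 2) ^ ?n) * measure lebesgue (ball x d)"
    by (intro exI[of _ ?d] exI[of _ "ball x ?d - ?V"]) simp
qed

section \<open>Slopes of Lipschitz pseudometrics\<close>

text \<open>
  Working with the pseudometric pulled back from the target, instead of the map, makes the extension
  from \<open>A\<close> to the whole space easy and removes the target space from all differentiability arguments.
\<close>

locale lipschitz_pseudometric =
  fixes D :: "'a::euclidean_space \<Rightarrow> 'a \<Rightarrow> real" and L :: real
  assumes L_pos: "0 < L"
    and D_sym: "D x y = D y x"
    and D_triangle: "D x z \<le> D x y + D y z"
    and D_le: "D x y \<le> L * dist x y"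
begin

lemma D_self [simp]: "D x x = 0"
  using D_triangle[of x x x] D_le[of x x] by simp

lemma D_nonneg [simp]: "0 \<le> D x y"
  using D_triangle[of x x y] D_sym[of x y] by simp

lemma D_move_right: "D x z \<le> D x y + L * dist y z"
  using D_triangle[of x z y] D_le[of y z] by simp

lemma D_move_left: "D y z \<le> D x z + L * dist x y"
  using D_triangle[of y z x] D_le[of y x] by (simp add: dist_commute)

lemma continuous_on_D:
  fixes f g :: "'b::topological_space \<Rightarrow> 'a"
  assumes "continuous_on S f" "continuous_on S g"
  shows "continuous_on S (\<lambda>x. D (f x) (g x))"
proof -
  have "dist (D p q) (D p' q') \<le> L * (dist p p' + dist q q')" for p q p' q'
    using D_move_right[of p' q' q] D_move_right[of p q q'] D_move_left[of p q p'] D_move_left[of p' q p]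
      D_move_left[of p q' p'] D_move_left[of p' q' p]
    by (auto simp: dist_real_def abs_le_iff algebra_simps dist_commute)
  note bound = this
  have lim: "((\<lambda>x. D (f x) (g x)) \<longlongrightarrow> D p q) F" if "(f \<longlongrightarrow> p) F" "(g \<longlongrightarrow> q) F" for p q F
  proof -
    have "((\<lambda>x. dist (f x) p) \<longlongrightarrow> 0) F" "((\<lambda>x. dist (g x) q) \<longlongrightarrow> 0) F"
      using that by (simp_all only: tendsto_dist_iff[symmetric])
    then have "((\<lambda>x. L * (dist (f x) p + dist (g x) q)) \<longlongrightarrow> L * (0 + 0)) F"
      by (intro tendsto_intros)
    then have lim0: "((\<lambda>x. L * (dist (f x) p + dist (g x) q)) \<longlongrightarrow> 0) F" by simp
    have "((\<lambda>x. dist (D (f x) (g x)) (D p q)) \<longlongrightarrow> 0) F"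
      by (rule tendsto_sandwich[OF _ _ tendsto_const lim0]) (simp_all only: bound zero_le_dist always_eventually simp_thms)
    then show ?thesis by (simp only: tendsto_dist_iff[symmetric])
  qed
  show ?thesis using assms unfolding continuous_on_def by (auto intro: lim)
qed

text \<open>
  The increments are positive here but of both signs in \<open>upper_slope_le\<close>: the proof of
  \<open>interval_bound_of_lower_slope\<close> moves to the right only, whereas the null directions have to
  form a subspace.
\<close>

definition lower_slope_less :: "real \<Rightarrow> 'a \<Rightarrow> 'a \<Rightarrow> bool" where
  "lower_slope_less c v x \<longleftrightarrow> (\<forall>r>0. \<exists>t. 0 < t \<and> t < r \<and> D x (x + t *\<^sub>R v) < c * t)"

definition upper_slope_le :: "real \<Rightarrow> 'a \<Rightarrow> 'a \<Rightarrow> bool" where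
  "upper_slope_le c v x \<longleftrightarrow> (\<exists>r>0. \<forall>t. \<bar>t\<bar> < r \<longrightarrow> D x (x + t *\<^sub>R v) \<le> c * \<bar>t\<bar>)"

end

text \<open>
  Continuous induction along \<open>[a, b]\<close>. Let \<open>V\<close> be an open set around \<open>[a, b] - E\<close> of almost the same
  measure. At a point of \<open>V\<close> one advances inside \<open>V\<close> at the rate \<open>L\<close>; at any other point, which lies in \<open>E\<close>,
  one advances by a step of slope at most \<open>c\<close>. The rightmost point that can be reached is \<open>b\<close>.
\<close>

lemma interval_bound_of_lower_slope:
  fixes d :: "real \<Rightarrow> real \<Rightarrow> real"
  assumes d: "lipschitz_pseudometric d L" and "a \<le> b" and "0 \<le> c" and E: "E \<in> sets lebesgue"
    and slope: "\<And>s r. s \<in> E \<Longrightarrow> 0 < r \<Longrightarrow> \<exists>t. 0 < t \<and> t < r \<and> d s (s + t) \<le> c * t"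
  shows "d a b \<le> c * (b - a) + L * measure lebesgue ({a..b} - E)"
proof -
  interpret lipschitz_pseudometric d L by fact
  let ?\<mu> = "measure lebesgue"
  have m: "{a..b} - E \<in> lmeasurable" using E by (intro fmeasurable_Diff) auto
  have "d a b \<le> c * (b - a) + L * (?\<mu> ({a..b} - E) + e)" if "0 < e" for e
  proof -
    obtain V where V: "open V" "{a..b} - E \<subseteq> V" "V - ({a..b} - E) \<in> lmeasurable"
      "emeasure lebesgue (V - ({a..b} - E)) < ennreal e"
      using sets_lebesgue_outer_open[of "{a..b} - E" e] m \<open>0 < e\<close> by auto
    have Veq: "V = ({a..b} - E) \<union> (V - ({a..b} - E))" using V by auto
    have Vm: "V \<in> lmeasurable" using V m by (subst Veq, intro fmeasurable.Un) auto
    have "?\<mu> (V - ({a..b} - E)) \<le> e"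
      using V(3,4) \<open>0 < e\<close> by (simp add: emeasure_eq_measure2 ennreal_less_iff)
    moreover have "?\<mu> V \<le> ?\<mu> ({a..b} - E) + ?\<mu> (V - ({a..b} - E))"
      using V m by (subst Veq, intro measure_Un_le) auto
    ultimately have Vle: "?\<mu> V \<le> ?\<mu> ({a..b} - E) + e" by simp
    \<comment> \<open>the cost allowed for reaching \<open>x\<close> from \<open>a\<close>\<close>
    define h where "h x = c * (x - a) + L * ?\<mu> (V \<inter> {a..x})" for x
    have mono: "?\<mu> (V \<inter> {a..x}) \<le> ?\<mu> (V \<inter> {a..y})" if "x \<le> y" for x y
      using that Vm by (intro measure_mono_fmeasurable) (auto intro!: fmeasurable_Int_fmeasurable)
    have hmono: "h x + c * (y - x) \<le> h y" if "x \<le> y" for x y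
      using mono[OF that] L_pos by (simp add: h_def algebra_simps)
    define X where "X = {x \<in> {a..b}. d a x \<le> h x}"
    have "a \<in> X" using \<open>a \<le> b\<close> L_pos by (simp add: X_def h_def)
    have bdd: "bdd_above X" by (auto simp: X_def intro!: bdd_aboveI[of _ b])
    define s where "s = Sup X"
    have s: "a \<le> s" "s \<le> b"
      using \<open>a \<in> X\<close> bdd unfolding s_def by (auto simp: X_def intro!: cSup_upper cSup_least)
    have ds: "d a s \<le> h s"
    proof (rule field_le_epsilon)
      fix \<epsilon> :: real assume "0 < \<epsilon>"
      then obtain x where x: "x \<in> X" "s - \<epsilon> / L < x"
        using less_cSupD[of X "s - \<epsilon> / L"] \<open>a \<in> X\<close> L_pos unfolding s_def by auto
      have "x \<le> s" unfolding s_def using x bdd by (intro cSup_upper)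
      have "d a s \<le> d a x + L * (s - x)"
        using D_move_right[of a s x] \<open>x \<le> s\<close> by (simp add: dist_real_def)
      also have "d a x \<le> h x" using x by (simp add: X_def)
      also have "h x \<le> h s" using hmono[OF \<open>x \<le> s\<close>] \<open>x \<le> s\<close> \<open>0 \<le> c\<close>
        by (smt (verit) mult_nonneg_nonneg)
      also have "L * (s - x) \<le> \<epsilon>" using x L_pos by (simp add: field_simps)
      finally show "d a s \<le> h s + \<epsilon>" by simp
    qed
    have "s = b"
    proof (rule ccontr)
      assume "s \<noteq> b"
      then have "s < b" using s by simp
      have contra: False if "s < y" "y \<le> b" "d a y \<le> h y" for y
        using that s bdd cSup_upper[of y X] by (auto simp: X_def s_def)
      show False
      proof (cases "s \<in> V")
        case True
        then obtain r where r: "0 < r" "cball s r \<subseteq> V" using V(1) open_contains_cball by blast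
        define y where "y = min (s + r) b"
        have y: "s < y" "y \<le> b" "{s..y} \<subseteq> V"
          using r \<open>s < b\<close> by (auto simp: y_def cball_def dist_real_def subset_iff)
        have "{s<..<y} \<in> lmeasurable" using lmeasurable_box[of s y] by simp
        moreover have "{s<..<y} - V \<inter> {a..s} = {s<..<y}" by auto
        ultimately have "?\<mu> (V \<inter> {a..s}) + (y - s) = ?\<mu> ((V \<inter> {a..s}) \<union> {s<..<y})"
          using Vm y by (subst measure_Un2) (auto intro!: fmeasurable_Int_fmeasurable)
        also have "\<dots> \<le> ?\<mu> (V \<inter> {a..y})"
        proof (rule measure_mono_fmeasurable)
          show "V \<inter> {a..s} \<union> {s<..<y} \<in> sets lebesgue"
            using Vm \<open>{s<..<y} \<in> lmeasurable\<close> by (intro sets.Un sets.Int) auto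
          show "V \<inter> {a..s} \<union> {s<..<y} \<subseteq> V \<inter> {a..y}" using y(1,3) s(1) by fastforce
          show "V \<inter> {a..y} \<in> lmeasurable" using Vm by (intro fmeasurable_Int_fmeasurable) auto
        qed
        finally have "L * ?\<mu> (V \<inter> {a..s}) + L * (y - s) \<le> L * ?\<mu> (V \<inter> {a..y})"
          using L_pos by (simp flip: distrib_left)
        moreover have "0 \<le> c * (y - s)" using \<open>0 \<le> c\<close> y by simp
        moreover have "d a y \<le> d a s + L * (y - s)"
          using D_move_right[of a y s] y by (simp add: dist_real_def)
        ultimately have "d a y \<le> h y" using ds by (simp add: h_def algebra_simps)
        then show False using contra y by blast
      next
        case False
        then have "s \<in> E" using V(2) s by auto
        then obtain t where t: "0 < t" "t < b - s" "d s (s + t) \<le> c * t"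
          using slope[of s "b - s"] \<open>s < b\<close> by auto
        have "d a (s + t) \<le> d a s + d s (s + t)" by (rule D_triangle)
        also have "\<dots> \<le> h s + c * t" using ds t by simp
        also have "\<dots> \<le> h (s + t)" using hmono[of s "s + t"] t by simp
        finally show False using contra[of "s + t"] t by simp
      qed
    qed
    then have "d a b \<le> c * (b - a) + L * ?\<mu> (V \<inter> {a..b})" using ds by (simp add: h_def)
    moreover have "?\<mu> (V \<inter> {a..b}) \<le> ?\<mu> V" using Vm by (intro measure_mono_fmeasurable) auto
    then have "L * ?\<mu> (V \<inter> {a..b}) \<le> L * (?\<mu> ({a..b} - E) + e)"
      using Vle L_pos by (intro mult_left_mono) auto
    ultimately show ?thesis by linarith
  qed
  note bound = this
  show ?thesis
  proof (rule field_le_epsilon)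
    fix \<epsilon> :: real assume "0 < \<epsilon>"
    then show "d a b \<le> c * (b - a) + L * ?\<mu> ({a..b} - E) + \<epsilon>"
      using bound[of "\<epsilon> / L"] L_pos by (simp add: distrib_left)
  qed
qed

text \<open>
  One-dimensional metric differentiability. Let \<open>E\<close> be the set of points with lower slope below \<open>c\<close>. If
  \<open>d s (s + h) > 2 c |h|\<close> for some \<open>s\<close> in \<open>E\<close>, the preceding bound forces the complement of \<open>E\<close> to fill at least
  the fraction \<open>c / L\<close> of the interval between \<open>s\<close> and \<open>s + h\<close>. If this happens for arbitrarily small
  \<open>h\<close>, then \<open>E\<close> does not have full density at \<open>s\<close>.
\<close>

lemma negligible_slope_gap_real:
  fixes d :: "real \<Rightarrow> real \<Rightarrow> real"
  assumes d: "lipschitz_pseudometric d L" and "0 < c"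
    and meas: "{s. lipschitz_pseudometric.lower_slope_less d c 1 s} \<in> sets lebesgue" (is "?E \<in> _")
  shows "negligible {s. lipschitz_pseudometric.lower_slope_less d c 1 s \<and>
    \<not> lipschitz_pseudometric.upper_slope_le d (2 * c) 1 s}" (is "negligible ?P")
proof -
  interpret lipschitz_pseudometric d L by fact
  show ?thesis
  proof (rule negligible_of_partial_density)
    \<comment> \<open>the ball of radius \<open>2 |h|\<close> has length \<open>4 |h|\<close>, of which at least \<open>(c / L) |h|\<close> lies outside \<open>E\<close>\<close>
    let ?c = "max 0 (1 - c / (4 * L))"
    show "0 \<le> ?c" "?c < 1" using \<open>0 < c\<close> L_pos by auto
    fix s r :: real assume s: "s \<in> ?P" and "0 < r"
    then have "\<forall>r>0. \<exists>h. \<bar>h\<bar> < r \<and> 2 * c * \<bar>h\<bar> < d s (s + h)"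
      unfolding upper_slope_le_def by (auto simp: not_le)
    moreover have "0 < r / 2" using \<open>0 < r\<close> by simp
    ultimately obtain h where h: "\<bar>h\<bar> < r / 2" "2 * c * \<bar>h\<bar> < d s (s + h)" by blast
    then have "h \<noteq> 0" by auto
    define a b where "a = min s (s + h)" and "b = max s (s + h)"
    have ab: "a \<le> b" "b - a = \<bar>h\<bar>" "d a b = d s (s + h)"
      using D_sym by (auto simp: a_def b_def min_def max_def)
    have "d a b \<le> c * (b - a) + L * measure lebesgue ({a..b} - ?E)"
      by (rule interval_bound_of_lower_slope[OF d])
        (use ab \<open>0 < c\<close> meas in \<open>auto simp: lower_slope_less_def intro: less_imp_le\<close>)
    then have gap: "c * \<bar>h\<bar> \<le> L * measure lebesgue ({a..b} - ?E)" using ab h by simp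
    let ?U = "ball s (2 * \<bar>h\<bar>) - ({a..b} - ?E)"
    have m: "{a..b} - ?E \<in> lmeasurable" using meas by (intro fmeasurable_Diff) auto
    have sub: "{a..b} - ?E \<subseteq> ball s (2 * \<bar>h\<bar>)"
      using \<open>h \<noteq> 0\<close> by (auto simp: a_def b_def dist_real_def)
    have ball: "measure lebesgue (ball s (2 * \<bar>h\<bar>)) = 4 * \<bar>h\<bar>"
      by (simp add: ball_eq_greaterThanLessThan)
    have "measure lebesgue ?U = 4 * \<bar>h\<bar> - measure lebesgue ({a..b} - ?E)"
      using sub m by (subst measurable_measure_Diff) (auto simp: ball)
    also have "\<dots> \<le> (1 - c / (4 * L)) * (4 * \<bar>h\<bar>)"
      using gap L_pos by (simp add: field_simps)
    also have "\<dots> \<le> ?c * measure lebesgue (ball s (2 * \<bar>h\<bar>))"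
      unfolding ball by (intro mult_right_mono) auto
    finally have "measure lebesgue ?U \<le> ?c * measure lebesgue (ball s (2 * \<bar>h\<bar>))" .
    moreover have "?P \<inter> ball s (2 * \<bar>h\<bar>) \<subseteq> ?U" by blast
    moreover have "0 < 2 * \<bar>h\<bar>" "2 * \<bar>h\<bar> \<le> r" using h(1) \<open>h \<noteq> 0\<close> by auto
    moreover have "?U \<in> lmeasurable" using m by (intro fmeasurable_Diff) auto
    ultimately show "\<exists>e U. 0 < e \<and> e \<le> r \<and> ?P \<inter> ball s e \<subseteq> U \<and> U \<in> lmeasurable \<and>
        measure lebesgue U \<le> ?c * measure lebesgue (ball s e)"
      by (intro exI[of _ "2 * \<bar>h\<bar>"] exI[of _ ?U]) (simp only: simp_thms)
  qed
qed

context lipschitz_pseudometric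
begin

lemma lower_slope_less_borel: "{x. lower_slope_less c v x} \<in> sets borel"
proof -
  have eq: "{x. lower_slope_less c v x} =
      (\<Inter>i. \<Union>t\<in>{0<..<1 / real (Suc i)}. {x. D x (x + t *\<^sub>R v) < c * t})"
  proof (intro set_eqI iffI)
    fix x assume "x \<in> {x. lower_slope_less c v x}"
    then have *: "\<And>r. r > 0 \<Longrightarrow> \<exists>t. 0 < t \<and> t < r \<and> D x (x + t *\<^sub>R v) < c * t"
      by (simp add: lower_slope_less_def)
    have "\<exists>t\<in>{0<..<1 / real (Suc i)}. D x (x + t *\<^sub>R v) < c * t" for i
      using *[of "1 / real (Suc i)"] by auto
    then show "x \<in> (\<Inter>i. \<Union>t\<in>{0<..<1 / real (Suc i)}. {x. D x (x + t *\<^sub>R v) < c * t})" by blast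
  next
    fix x assume x: "x \<in> (\<Inter>i. \<Union>t\<in>{0<..<1 / real (Suc i)}. {x. D x (x + t *\<^sub>R v) < c * t})"
    have "\<exists>t. 0 < t \<and> t < r \<and> D x (x + t *\<^sub>R v) < c * t" if "r > 0" for r
    proof -
      obtain i where "1 / real (Suc i) < r" using reals_Archimedean[OF \<open>r > 0\<close>] by (auto simp: inverse_eq_divide)
      moreover obtain t where "t \<in> {0<..<1 / real (Suc i)}" "D x (x + t *\<^sub>R v) < c * t" using x by blast
      ultimately show ?thesis by (intro exI[of _ t]) auto
    qed
    then show "x \<in> {x. lower_slope_less c v x}" by (simp add: lower_slope_less_def)
  qed
  have "open {x. D x (x + t *\<^sub>R v) < c * t}" for t
    by (intro open_Collect_less continuous_on_D continuous_intros)
  then show ?thesis unfolding eq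
    by (intro sets.countable_INT'' borel_open open_UN ballI) simp_all
qed

lemma closed_upper_slope_le_on: "closed {x. \<forall>t. \<bar>t\<bar> < r \<longrightarrow> D x (x + t *\<^sub>R v) \<le> c * \<bar>t\<bar>}"
proof -
  have eq: "{x. \<forall>t. \<bar>t\<bar> < r \<longrightarrow> D x (x + t *\<^sub>R v) \<le> c * \<bar>t\<bar>} =
      (\<Inter>t\<in>{t. \<bar>t\<bar> < r}. {x. D x (x + t *\<^sub>R v) \<le> c * \<bar>t\<bar>})" by blast
  show ?thesis unfolding eq
    by (intro closed_INT ballI closed_Collect_le continuous_on_D continuous_intros)
qed

lemma upper_slope_le_iff:
  "upper_slope_le c v x \<longleftrightarrow> (\<exists>i::nat. \<forall>t. \<bar>t\<bar> < 1 / real (Suc i) \<longrightarrow> D x (x + t *\<^sub>R v) \<le> c * \<bar>t\<bar>)"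
proof
  assume "upper_slope_le c v x"
  then obtain r where r: "r > 0" "\<And>t. \<bar>t\<bar> < r \<Longrightarrow> D x (x + t *\<^sub>R v) \<le> c * \<bar>t\<bar>"
    by (auto simp: upper_slope_le_def)
  obtain i where "1 / real (Suc i) < r" using reals_Archimedean[OF \<open>r > 0\<close>] by (auto simp: inverse_eq_divide)
  then have "\<forall>t. \<bar>t\<bar> < 1 / real (Suc i) \<longrightarrow> D x (x + t *\<^sub>R v) \<le> c * \<bar>t\<bar>" using r(2) less_trans by blast
  then show "\<exists>i::nat. \<forall>t. \<bar>t\<bar> < 1 / real (Suc i) \<longrightarrow> D x (x + t *\<^sub>R v) \<le> c * \<bar>t\<bar>" ..
next
  assume "\<exists>i::nat. \<forall>t. \<bar>t\<bar> < 1 / real (Suc i) \<longrightarrow> D x (x + t *\<^sub>R v) \<le> c * \<bar>t\<bar>"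
  then obtain i :: nat where "\<forall>t. \<bar>t\<bar> < 1 / real (Suc i) \<longrightarrow> D x (x + t *\<^sub>R v) \<le> c * \<bar>t\<bar>" ..
  moreover have "0 < 1 / real (Suc i)" by simp
  ultimately show "upper_slope_le c v x" unfolding upper_slope_le_def by blast
qed

lemma upper_slope_le_borel: "{x. upper_slope_le c v x} \<in> sets borel"
proof -
  have eq: "{x. upper_slope_le c v x} =
      (\<Union>i. {x. \<forall>t. \<bar>t\<bar> < 1 / real (Suc i) \<longrightarrow> D x (x + t *\<^sub>R v) \<le> c * \<bar>t\<bar>})"
    unfolding upper_slope_le_iff by blast
  show ?thesis unfolding eq
    by (intro sets.countable_UN'' borel_closed closed_upper_slope_le_on) auto
qed

text \<open>
  The lines with direction \<open>v\<close> reduce this to dimension one. Instead of rotating coordinates, Fubini's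
  theorem is applied to the pairs \<open>(x, s)\<close> with \<open>x + s v\<close> in the exceptional set \<open>N\<close>: for every \<open>x\<close> almost no
  \<open>s\<close> occurs, so for some \<open>s\<close> the translate of \<open>N\<close> by \<open>- s v\<close> is null.
\<close>

lemma negligible_slope_gap:
  assumes "0 < c"
  shows "negligible {x. lower_slope_less c v x \<and> \<not> upper_slope_le (2 * c) v x}" (is "negligible ?N")
proof (cases "v = 0")
  case True
  then have "upper_slope_le (2 * c) v x" for x
    using \<open>0 < c\<close> unfolding upper_slope_le_def by (intro exI[of _ 1]) simp
  then show ?thesis by simp
next
  case False
  have N: "?N \<in> sets borel"
  proof -
    have "?N = {x. lower_slope_less c v x} - {x. upper_slope_le (2 * c) v x}" by blast
    then show ?thesis using lower_slope_less_borel upper_slope_le_borel by simp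
  qed
  have slice: "AE s in lborel. x + s *\<^sub>R v \<notin> ?N" for x
  proof -
    let ?d = "\<lambda>s t. D (x + s *\<^sub>R v) (x + t *\<^sub>R v)"
    have d: "lipschitz_pseudometric ?d (L * norm v)"
    proof
      show "0 < L * norm v" using L_pos False by simp
      fix s t u :: real
      show "?d s t = ?d t s" by (rule D_sym)
      show "?d s u \<le> ?d s t + ?d t u" by (rule D_triangle)
      have "dist (x + s *\<^sub>R v) (x + t *\<^sub>R v) = norm v * dist s t"
        by (simp add: dist_norm flip: scaleR_diff_left)
      then show "?d s t \<le> L * norm v * dist s t" using D_le by (metis mult.assoc)
    qed
    have low: "lipschitz_pseudometric.lower_slope_less ?d c 1 s \<longleftrightarrow> lower_slope_less c v (x + s *\<^sub>R v)" for s
      unfolding lipschitz_pseudometric.lower_slope_less_def[OF d] lower_slope_less_def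
      by (simp add: scaleR_left_distrib add.assoc)
    have up: "lipschitz_pseudometric.upper_slope_le ?d (2 * c) 1 s \<longleftrightarrow> upper_slope_le (2 * c) v (x + s *\<^sub>R v)" for s
      unfolding lipschitz_pseudometric.upper_slope_le_def[OF d] upper_slope_le_def
      by (simp add: scaleR_left_distrib add.assoc)
    have "(\<lambda>s. x + s *\<^sub>R v) \<in> borel_measurable borel" by measurable
    from measurable_sets[OF this lower_slope_less_borel[of c v]]
    have "{s. lipschitz_pseudometric.lower_slope_less ?d c 1 s} \<in> sets lebesgue"
      unfolding low by (simp add: vimage_def)
    from negligible_slope_gap_real[OF d \<open>0 < c\<close> this]
    have "negligible {s. x + s *\<^sub>R v \<in> ?N}" unfolding low up by simp
    then have "AE s in lebesgue. s \<notin> {s. x + s *\<^sub>R v \<in> ?N}"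
      by (intro AE_not_in) (simp only: negligible_iff_null_sets)
    then show ?thesis by (simp only: AE_completion_iff mem_Collect_eq)
  qed
  have "{p \<in> space (lborel \<Otimes>\<^sub>M lborel). fst p + snd p *\<^sub>R v \<notin> B} \<in> sets (lborel \<Otimes>\<^sub>M lborel)"
    if "B \<in> sets borel" for B
  proof -
    have "(\<lambda>p::'a \<times> real. fst p + snd p *\<^sub>R v) \<in> borel_measurable (lborel \<Otimes>\<^sub>M lborel)" by measurable
    from measurable_sets[OF this borel_comp[OF that]] show ?thesis
      by (simp add: vimage_def Collect_conj_eq Int_commute)
  qed
  from this[OF N]
  have "{p \<in> space (lborel \<Otimes>\<^sub>M lborel). fst p + snd p *\<^sub>R v \<notin> ?N} \<in> sets (lborel \<Otimes>\<^sub>M lborel)" .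
  from lborel_pair.AE_commute[OF this]
  have "AE s in lborel. AE x in lborel. x + s *\<^sub>R v \<notin> ?N" using slice by (simp only: always_eventually simp_thms)
  moreover have "ae_filter (lborel :: real measure) \<noteq> bot" by (simp add: ae_filter_eq_bot_iff)
  ultimately obtain s where "AE x in lborel. x + s *\<^sub>R v \<notin> ?N"
    using eventually_happens' by blast
  then have "AE x in lebesgue. x + s *\<^sub>R v \<notin> ?N" by (simp only: AE_completion_iff)
  moreover have "{x. x + s *\<^sub>R v \<in> ?N} \<in> sets lebesgue"
  proof -
    have "(\<lambda>x. x + s *\<^sub>R v) \<in> borel_measurable borel" by measurable
    from measurable_sets[OF this N] show ?thesis by (simp add: vimage_def)
  qed
  ultimately have "negligible {x. x + s *\<^sub>R v \<in> ?N}"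
    by (simp add: negligible_iff_null_sets AE_iff_null_sets)
  moreover have "{x. x + s *\<^sub>R v \<in> ?N} = (+) (- (s *\<^sub>R v)) ` ?N"
  proof (intro set_eqI iffI)
    fix x assume "x \<in> {x. x + s *\<^sub>R v \<in> ?N}"
    then show "x \<in> (+) (- (s *\<^sub>R v)) ` ?N" by (intro image_eqI[of _ _ "x + s *\<^sub>R v"]) auto
  qed (auto simp: algebra_simps)
  ultimately have "negligible ((+) (- (s *\<^sub>R v)) ` ?N)" by (simp only:)
  then show ?thesis by (rule negligible_translation_rev)
qed

text \<open>
  Let \<open>S\<close> be the set of points where the slope bound in direction \<open>v\<close> holds up to a fixed scale. For
  almost every \<open>x\<close> in \<open>S\<close> the point \<open>x + t u\<close> is so close to a point \<open>y\<close> of \<open>S\<close> that one can go from \<open>x\<close> to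
  \<open>x + t u\<close>, on to \<open>y\<close>, to \<open>y + t v\<close> and finally to \<open>x + t (u + v)\<close>, at total cost \<open>3 c |t|\<close>.
\<close>

lemma negligible_not_subadditive:
  assumes "0 < c"
  shows "negligible {x. upper_slope_le c u x \<and> upper_slope_le c v x \<and> \<not> upper_slope_le (3 * c) (u + v) x}"
proof (cases "u = 0")
  case True
  have "upper_slope_le (3 * c) (u + v) x" if "upper_slope_le c v x" for x
  proof -
    obtain r where r: "r > 0" "\<And>t. \<bar>t\<bar> < r \<Longrightarrow> D x (x + t *\<^sub>R v) \<le> c * \<bar>t\<bar>"
      using \<open>upper_slope_le c v x\<close> by (auto simp: upper_slope_le_def)
    have "D x (x + t *\<^sub>R (u + v)) \<le> 3 * c * \<bar>t\<bar>" if "\<bar>t\<bar> < r" for t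
    proof -
      have "0 \<le> c * \<bar>t\<bar>" using \<open>0 < c\<close> by simp
      then have "c * \<bar>t\<bar> \<le> 3 * c * \<bar>t\<bar>" by linarith
      then show ?thesis using r(2)[OF that] True by simp
    qed
    then show ?thesis using r(1) by (auto simp: upper_slope_le_def)
  qed
  then have "{x. upper_slope_le c u x \<and> upper_slope_le c v x \<and> \<not> upper_slope_le (3 * c) (u + v) x} = {}" by blast
  then show ?thesis by (simp only: negligible_empty)
next
  case False
  define \<eta> where "\<eta> = min 1 (c / (2 * L * norm u))"
  have \<eta>: "0 < \<eta>" "\<eta> \<le> 1" "2 * (L * (\<eta> * norm u)) \<le> c"
  proof -
    show "0 < \<eta>" "\<eta> \<le> 1" using False L_pos \<open>0 < c\<close> by (auto simp: \<eta>_def)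
    have "\<eta> \<le> c / (2 * L * norm u)" by (simp add: \<eta>_def)
    then show "2 * (L * (\<eta> * norm u)) \<le> c" using False L_pos by (simp add: field_simps)
  qed
  define S where "S i = {x. \<forall>t. \<bar>t\<bar> < 1 / real (Suc i) \<longrightarrow> D x (x + t *\<^sub>R v) \<le> c * \<bar>t\<bar>}" for i :: nat
  define P where "P i = {x \<in> S i. \<forall>r>0. \<exists>w. w \<noteq> 0 \<and> norm w < r \<and> ball (x + w) (\<eta> * norm w) \<inter> S i = {}}" for i
  have "negligible (\<Union>(range P))"
    using negligible_porous[OF \<eta>(1,2)] unfolding P_def
    by (simp only: negligible_iff_null_sets) (rule null_sets_UN)
  moreover have "{x. upper_slope_le c u x \<and> upper_slope_le c v x \<and> \<not> upper_slope_le (3 * c) (u + v) x} \<subseteq> \<Union>(range P)"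
  proof (rule subsetI, rule ccontr)
    fix x assume x: "x \<in> {x. upper_slope_le c u x \<and> upper_slope_le c v x \<and> \<not> upper_slope_le (3 * c) (u + v) x}"
      and nP: "x \<notin> \<Union>(range P)"
    obtain r where r: "r > 0" "\<And>t. \<bar>t\<bar> < r \<Longrightarrow> D x (x + t *\<^sub>R u) \<le> c * \<bar>t\<bar>"
      using x by (auto simp: upper_slope_le_def)
    obtain i where i: "x \<in> S i" using x unfolding S_def upper_slope_le_iff by blast
    have "x \<notin> P i" using nP by blast
    then have "\<not> (\<forall>r>0. \<exists>w. w \<noteq> 0 \<and> norm w < r \<and> ball (x + w) (\<eta> * norm w) \<inter> S i = {})"
      using i unfolding P_def by simp
    then obtain r' where r': "r' > 0" "\<And>w. w \<noteq> 0 \<Longrightarrow> norm w < r' \<Longrightarrow> ball (x + w) (\<eta> * norm w) \<inter> S i \<noteq> {}"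
      by blast
    \<comment> \<open>the bounds at \<open>x\<close> and on \<open>S i\<close> hold up to this scale, and \<open>t u\<close> is short enough for the porosity estimate\<close>
    define \<rho> where "\<rho> = min (min r (1 / real (Suc i))) (r' / norm u)"
    have "\<rho> > 0" using r r' False by (simp add: \<rho>_def)
    have "D x (x + t *\<^sub>R (u + v)) \<le> 3 * c * \<bar>t\<bar>" if t: "\<bar>t\<bar> < \<rho>" for t
    proof (cases "t = 0")
      case nz: False
      have "norm (t *\<^sub>R u) < r'" using t False by (simp add: \<rho>_def field_simps)
      moreover have "t *\<^sub>R u \<noteq> 0" using nz False by simp
      ultimately have "ball (x + t *\<^sub>R u) (\<eta> * norm (t *\<^sub>R u)) \<inter> S i \<noteq> {}" using r'(2) by blast
      then obtain y where y: "dist (x + t *\<^sub>R u) y < \<eta> * norm (t *\<^sub>R u)" "y \<in> S i"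
        by (auto simp del: norm_scaleR)
      let ?e = "L * (\<eta> * norm u) * \<bar>t\<bar>"
      have e: "L * dist (x + t *\<^sub>R u) y \<le> ?e"
      proof -
        have "L * dist (x + t *\<^sub>R u) y \<le> L * (\<eta> * norm (t *\<^sub>R u))"
          using y(1) L_pos by (intro mult_left_mono) auto
        also have "\<dots> = ?e" by simp
        finally show ?thesis .
      qed
      have "D (x + t *\<^sub>R u) y \<le> ?e" using D_le[of "x + t *\<^sub>R u" y] e by simp
      moreover have "D (y + t *\<^sub>R v) (x + t *\<^sub>R (u + v)) \<le> ?e"
      proof -
        have "dist (y + t *\<^sub>R v) (x + t *\<^sub>R (u + v)) = dist (x + t *\<^sub>R u) y"
          by (simp add: dist_norm algebra_simps norm_minus_commute)
        then show ?thesis using D_le[of "y + t *\<^sub>R v" "x + t *\<^sub>R (u + v)"] e by simp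
      qed
      moreover have "D y (y + t *\<^sub>R v) \<le> c * \<bar>t\<bar>" using y(2) t by (simp add: S_def \<rho>_def)
      moreover have "D x (x + t *\<^sub>R u) \<le> c * \<bar>t\<bar>" using r(2) t by (simp add: \<rho>_def)
      moreover have "D x (x + t *\<^sub>R (u + v)) \<le> D x (x + t *\<^sub>R u) + (D (x + t *\<^sub>R u) y + (D y (y + t *\<^sub>R v) + D (y + t *\<^sub>R v) (x + t *\<^sub>R (u + v))))"
        by (intro order_trans[OF D_triangle[of _ _ "x + t *\<^sub>R u"] add_left_mono]
            order_trans[OF D_triangle[of _ _ y] add_left_mono] D_triangle)
      moreover have "2 * ?e \<le> c * \<bar>t\<bar>"
        using mult_right_mono[OF \<eta>(3), of "\<bar>t\<bar>"] by (simp add: mult.assoc)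
      ultimately show ?thesis by linarith
    qed simp
    then have "upper_slope_le (3 * c) (u + v) x" using \<open>\<rho> > 0\<close> unfolding upper_slope_le_def by blast
    then show False using x by blast
  qed
  ultimately show ?thesis by (rule negligible_subset)
qed

lemma upper_slope_le_perturb:
  assumes "upper_slope_le c v x" and "c + L * dist v w \<le> c'"
  shows "upper_slope_le c' w x"
proof -
  obtain r where r: "r > 0" "\<And>t. \<bar>t\<bar> < r \<Longrightarrow> D x (x + t *\<^sub>R v) \<le> c * \<bar>t\<bar>"
    using assms(1) by (auto simp: upper_slope_le_def)
  have "D x (x + t *\<^sub>R w) \<le> c' * \<bar>t\<bar>" if "\<bar>t\<bar> < r" for t
  proof -
    have "dist (x + t *\<^sub>R v) (x + t *\<^sub>R w) = dist v w * \<bar>t\<bar>"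
      by (simp add: dist_norm flip: scaleR_diff_right)
    then have "D x (x + t *\<^sub>R w) \<le> c * \<bar>t\<bar> + L * dist v w * \<bar>t\<bar>"
      using D_move_right[of x "x + t *\<^sub>R w" "x + t *\<^sub>R v"] r(2)[OF that] by simp
    also have "\<dots> = (c + L * dist v w) * \<bar>t\<bar>" by (simp add: distrib_right)
    also have "\<dots> \<le> c' * \<bar>t\<bar>" using assms(2) by (rule mult_right_mono) simp
    finally show ?thesis .
  qed
  then show ?thesis using r(1) unfolding upper_slope_le_def by blast
qed

lemma lower_slope_less_perturb:
  assumes "lower_slope_less c v x" and "c + L * dist v w \<le> c'"
  shows "lower_slope_less c' w x"
  unfolding lower_slope_less_def
proof (intro allI impI)
  fix r :: real assume "0 < r"
  then obtain t where t: "0 < t" "t < r" "D x (x + t *\<^sub>R v) < c * t"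
    using assms(1) by (auto simp: lower_slope_less_def)
  have "dist (x + t *\<^sub>R v) (x + t *\<^sub>R w) = dist v w * t"
    using t by (simp add: dist_norm flip: scaleR_diff_right)
  then have "D x (x + t *\<^sub>R w) < c * t + L * dist v w * t"
    using D_move_right[of x "x + t *\<^sub>R w" "x + t *\<^sub>R v"] t by simp
  also have "\<dots> = (c + L * dist v w) * t" by (simp add: distrib_right)
  also have "\<dots> \<le> c' * t" using assms(2) t by (intro mult_right_mono) auto
  finally show "\<exists>t>0. t < r \<and> D x (x + t *\<^sub>R w) < c' * t" using t by blast
qed

text \<open>
  The kernel of the metric differential of \<open>D\<close> at \<open>x\<close>, defined without assuming that the differential
  exists.
\<close>

definition null_directions :: "'a \<Rightarrow> 'a set" where
  "null_directions x = {v. \<forall>c>0. upper_slope_le c v x}"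

definition regular_point :: "'a \<Rightarrow> bool" where
  "regular_point x \<longleftrightarrow> subspace (null_directions x) \<and>
     (\<forall>v. (\<forall>c>0. lower_slope_less c v x) \<longrightarrow> v \<in> null_directions x)"

text \<open>
  The exceptional sets of the two previous results are null for each direction and each \<open>c\<close>; they are
  taken for directions in a countable dense set and \<open>c = 1 / (i + 1)\<close>. Slopes depend on the direction
  in an \<open>L\<close>-Lipschitz way, which transfers the conclusions to all directions; the factors 2 and 3
  lost on the way do no harm because \<open>c\<close> is arbitrary.
\<close>

lemma negligible_not_regular_point: "negligible {x. \<not> regular_point x}"
proof -
  obtain Q :: "'a set" where Q: "countable Q" "\<And>X. open X \<Longrightarrow> X \<noteq> {} \<Longrightarrow> \<exists>q\<in>Q. q \<in> X"
    using countable_dense_setE by blast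
  have near: "\<exists>q\<in>Q. dist v q < e" if "0 < e" for v e
    using Q(2)[of "ball v e"] that by auto
  define c where "c i = 1 / real (Suc i)" for i
  have cpos: "0 < c i" for i by (simp add: c_def)
  define N1 where "N1 = (\<Union>(v,i)\<in>Q \<times> UNIV. {x. lower_slope_less (c i) v x \<and> \<not> upper_slope_le (2 * c i) v x})"
  define N2 where "N2 = (\<Union>(u,v,i)\<in>Q \<times> Q \<times> UNIV. {x. upper_slope_le (c i) u x \<and> upper_slope_le (c i) v x \<and>
      \<not> upper_slope_le (3 * c i) (u + v) x})"
  have cnt: "countable (Q \<times> (UNIV::nat set))" "countable (Q \<times> Q \<times> (UNIV::nat set))" using Q(1) by auto
  have "N1 \<in> null_sets lebesgue"
    unfolding N1_def using negligible_slope_gap[OF cpos]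
    by (intro null_sets_UN' cnt) (auto simp: negligible_iff_null_sets)
  moreover have "N2 \<in> null_sets lebesgue"
    unfolding N2_def using negligible_not_subadditive[OF cpos]
    by (intro null_sets_UN' cnt) (auto simp: negligible_iff_null_sets)
  ultimately have N: "negligible (N1 \<union> N2)" by (simp add: negligible_iff_null_sets null_sets.Un)
  have "regular_point x" if "x \<notin> N1 \<union> N2" for x
  proof -
    have n1: "upper_slope_le (2 * c i) v x" if "lower_slope_less (c i) v x" "v \<in> Q" for v i
      using \<open>x \<notin> N1 \<union> N2\<close> that unfolding N1_def by blast
    have n2: "upper_slope_le (3 * c i) (u + v) x" if "upper_slope_le (c i) u x" "upper_slope_le (c i) v x" "u \<in> Q" "v \<in> Q" for u v i
      using \<open>x \<notin> N1 \<union> N2\<close> that unfolding N2_def by blast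
    have small: "\<exists>i. 4 * c i < e" if "0 < e" for e
    proof -
      obtain i where "inverse (real (Suc i)) < e / 4" using reals_Archimedean[of "e / 4"] \<open>0 < e\<close> by auto
      then show ?thesis by (intro exI[of _ i]) (simp add: c_def inverse_eq_divide)
    qed
    have close: "\<exists>q\<in>Q. L * dist v q \<le> c i / 2" for v i
    proof -
      obtain q where "q \<in> Q" "dist v q < c i / (2 * L)"
        using near[of "c i / (2 * L)" v] cpos[of i] L_pos by auto
      then show ?thesis using L_pos by (intro bexI[of _ q]) (auto simp: field_simps)
    qed
    have low: "v \<in> null_directions x" if v: "\<And>c. 0 < c \<Longrightarrow> lower_slope_less c v x" for v
      unfolding null_directions_def
    proof (intro CollectI allI impI)
      fix e :: real assume "0 < e"
      then obtain i where i: "4 * c i < e" using small by blast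
      obtain q where q: "q \<in> Q" "L * dist v q \<le> c i / 2" using close by blast
      have "lower_slope_less (c i) q x"
        using lower_slope_less_perturb[OF v[of "c i / 2"], of q "c i"] q cpos[of i] by simp
      then have "upper_slope_le (2 * c i) q x" using n1 q by blast
      then show "upper_slope_le e v x"
        using q i cpos[of i] by (elim upper_slope_le_perturb) (simp add: dist_commute)
    qed
    moreover have "subspace (null_directions x)"
    proof (rule subspaceI)
      show "0 \<in> null_directions x"
        unfolding null_directions_def upper_slope_le_def by (auto intro!: exI[of _ 1])
    next
      fix u v assume uv: "u \<in> null_directions x" "v \<in> null_directions x"
      show "u + v \<in> null_directions x"
        unfolding null_directions_def
      proof (intro CollectI allI impI)
        fix e :: real assume "0 < e"
        then obtain i where i: "4 * c i < e" using small by blast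
        obtain p where p: "p \<in> Q" "L * dist u p \<le> c i / 2" using close by blast
        obtain q where q: "q \<in> Q" "L * dist v q \<le> c i / 2" using close by blast
        have half: "upper_slope_le (c i / 2) u x" "upper_slope_le (c i / 2) v x"
          using uv cpos[of i] by (simp_all add: null_directions_def)
        have "upper_slope_le (c i) p x" by (rule upper_slope_le_perturb[OF half(1)]) (use p in simp)
        moreover have "upper_slope_le (c i) q x" by (rule upper_slope_le_perturb[OF half(2)]) (use q in simp)
        ultimately have "upper_slope_le (3 * c i) (p + q) x" using n2 p q by blast
        moreover have "3 * c i + L * dist (p + q) (u + v) \<le> e"
        proof -
          have "dist (p + q) (u + v) \<le> dist u p + dist v q"
            using dist_triangle_add[of p q u v] by (simp add: dist_commute)
          then have "L * dist (p + q) (u + v) \<le> L * (dist u p + dist v q)"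
            using L_pos by (intro mult_left_mono) auto
          then show ?thesis using p q i by (simp add: distrib_left)
        qed
        ultimately show "upper_slope_le e (u + v) x" by (rule upper_slope_le_perturb)
      qed
    next
      fix a v assume v: "v \<in> null_directions x"
      show "a *\<^sub>R v \<in> null_directions x"
      proof (cases "a = 0")
        case True
        then show ?thesis unfolding null_directions_def upper_slope_le_def by (auto intro!: exI[of _ 1])
      next
        case False
        show ?thesis unfolding null_directions_def
        proof (intro CollectI allI impI)
          fix e :: real assume "0 < e"
          then have "0 < e / \<bar>a\<bar>" using False by simp
          then have "upper_slope_le (e / \<bar>a\<bar>) v x" using v unfolding null_directions_def by blast
          then obtain r where r: "r > 0" "\<And>t. \<bar>t\<bar> < r \<Longrightarrow> D x (x + t *\<^sub>R v) \<le> e / \<bar>a\<bar> * \<bar>t\<bar>"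
            unfolding upper_slope_le_def by blast
          have "D x (x + t *\<^sub>R (a *\<^sub>R v)) \<le> e * \<bar>t\<bar>" if "\<bar>t\<bar> < r / \<bar>a\<bar>" for t
            using r(2)[of "t * a"] that False by (simp add: abs_mult field_simps)
          moreover have "0 < r / \<bar>a\<bar>" using r False by simp
          ultimately show "upper_slope_le e (a *\<^sub>R v) x" unfolding upper_slope_le_def by blast
        qed
      qed
    qed
    ultimately show ?thesis unfolding regular_point_def by blast
  qed
  then have "{x. \<not> regular_point x} \<subseteq> N1 \<union> N2" by blast
  with N show ?thesis by (rule negligible_subset)
qed

end

section \<open>Values with fat fibres\<close>

text \<open>
  The selection step of Vitali's covering lemma, for an abstract conflict relation instead of the
  intersection of balls. In the application the sets that have to be disjoint lie in the domain of the map,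
  while the radii and the conflicts refer to its values.
\<close>

lemma independent_selection:
  fixes r :: "'z \<Rightarrow> real"
  assumes refl: "\<And>z. z \<in> Z \<Longrightarrow> conf z z" and sym: "\<And>z w. conf z w \<Longrightarrow> conf w z"
    and r: "\<And>z. z \<in> Z \<Longrightarrow> 0 < r z" "\<And>z. z \<in> Z \<Longrightarrow> r z \<le> B"
  obtains Y where "Y \<subseteq> Z" "\<And>z w. z \<in> Y \<Longrightarrow> w \<in> Y \<Longrightarrow> conf z w \<Longrightarrow> z = w"
    "\<And>z. z \<in> Z \<Longrightarrow> \<exists>w\<in>Y. conf z w \<and> r z \<le> 2 * r w"
proof -
  define \<F> where "\<F> = {Y. Y \<subseteq> Z \<and> (\<forall>z\<in>Y. \<forall>w\<in>Y. conf z w \<longrightarrow> z = w) \<and>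
      (\<forall>z\<in>Z. (\<exists>w\<in>Y. conf z w) \<longrightarrow> (\<exists>w\<in>Y. conf z w \<and> r z \<le> 2 * r w))}"
  have "\<exists>M\<in>\<F>. \<forall>X\<in>\<F>. M \<subseteq> X \<longrightarrow> X = M"
  proof (rule subset_Zorn_nonempty)
    have "{} \<in> \<F>" by (simp add: \<F>_def)
    then show "\<F> \<noteq> {}" by blast
    fix \<C> assume "\<C> \<noteq> {}" and chain: "subset.chain \<F> \<C>"
    have sub: "\<C> \<subseteq> \<F>" and tot: "\<And>X Y. X \<in> \<C> \<Longrightarrow> Y \<in> \<C> \<Longrightarrow> X \<subseteq> Y \<or> Y \<subseteq> X"
      using chain by (auto simp: subset.chain_def)
    have "\<Union>\<C> \<subseteq> Z" using sub by (auto simp: \<F>_def)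
    moreover have "z = w" if "z \<in> \<Union>\<C>" "w \<in> \<Union>\<C>" "conf z w" for z w
    proof -
      obtain X Y where XY: "X \<in> \<C>" "z \<in> X" "Y \<in> \<C>" "w \<in> Y" using \<open>z \<in> \<Union>\<C>\<close> \<open>w \<in> \<Union>\<C>\<close> by blast
      then obtain U where "U \<in> \<C>" "z \<in> U" "w \<in> U" using tot[of X Y] by blast
      then show ?thesis using sub \<open>conf z w\<close> by (auto simp: \<F>_def)
    qed
    moreover have "\<exists>w\<in>\<Union>\<C>. conf z w \<and> r z \<le> 2 * r w" if "z \<in> Z" "w \<in> \<Union>\<C>" "conf z w" for z w
    proof -
      obtain X where "X \<in> \<C>" "w \<in> X" using \<open>w \<in> \<Union>\<C>\<close> by blast
      then have "X \<in> \<F>" using sub by blast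
      then have "(\<exists>w\<in>X. conf z w) \<longrightarrow> (\<exists>w\<in>X. conf z w \<and> r z \<le> 2 * r w)"
        using \<open>z \<in> Z\<close> unfolding \<F>_def by simp
      then have "\<exists>w\<in>X. conf z w \<and> r z \<le> 2 * r w" using \<open>w \<in> X\<close> \<open>conf z w\<close> by blast
      then show ?thesis using \<open>X \<in> \<C>\<close> by blast
    qed
    ultimately show "\<Union>\<C> \<in> \<F>" unfolding \<F>_def by blast
  qed
  then obtain M where M: "M \<in> \<F>" and max: "\<And>X. X \<in> \<F> \<Longrightarrow> M \<subseteq> X \<Longrightarrow> X = M" by blast
  define R where "R = {z \<in> Z. \<forall>w\<in>M. \<not> conf z w}"
  have "R = {}"
  proof (rule ccontr)
    assume "R \<noteq> {}"
    have bdd: "bdd_above (r ` R)" using r(2) by (auto simp: R_def intro!: bdd_aboveI[of _ B])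
    obtain z1 where "z1 \<in> R" using \<open>R \<noteq> {}\<close> by blast
    then have "0 < r z1" using r(1) by (auto simp: R_def)
    then have "0 < Sup (r ` R)" using \<open>z1 \<in> R\<close> bdd by (meson cSUP_upper less_le_trans)
    then have "Sup (r ` R) / 2 < Sup (r ` R)" by simp
    then obtain z0 where z0: "z0 \<in> R" "Sup (r ` R) / 2 < r z0"
      using \<open>R \<noteq> {}\<close> bdd by (subst (asm) less_cSUP_iff) auto
    have "insert z0 M \<in> \<F>"
    proof -
      have ind: "\<And>z w. z \<in> M \<Longrightarrow> w \<in> M \<Longrightarrow> conf z w \<Longrightarrow> z = w" and MZ: "M \<subseteq> Z"
        and dom: "\<And>z w. z \<in> Z \<Longrightarrow> w \<in> M \<Longrightarrow> conf z w \<Longrightarrow> \<exists>w\<in>M. conf z w \<and> r z \<le> 2 * r w"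
        using M unfolding \<F>_def by blast+
      have no: "\<not> conf z0 w" "\<not> conf w z0" if "w \<in> M" for w
        using z0(1) that sym unfolding R_def by blast+
      have "\<exists>w\<in>insert z0 M. conf z w \<and> r z \<le> 2 * r w" if "z \<in> Z" "w \<in> insert z0 M" "conf z w" for z w
      proof (cases "z \<in> R")
        case True
        then have "w = z0" using that unfolding R_def by blast
        moreover have "r z \<le> Sup (r ` R)" using True bdd by (rule cSUP_upper)
        ultimately show ?thesis using z0(2) \<open>conf z w\<close> by (intro bexI[of _ z0]) auto
      next
        case False
        then obtain w' where "w' \<in> M" "conf z w'" using \<open>z \<in> Z\<close> unfolding R_def by blast
        then show ?thesis using dom[OF \<open>z \<in> Z\<close>] by blast
      qed
      moreover have "insert z0 M \<subseteq> Z" using MZ z0(1) unfolding R_def by blast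
      ultimately show ?thesis unfolding \<F>_def using ind no by blast
    qed
    then have "z0 \<in> M" using max[of "insert z0 M"] by blast
    then show False using z0(1) refl unfolding R_def by blast
  qed
  show ?thesis
  proof (rule that[of M])
    fix z assume "z \<in> Z"
    then have "\<exists>w\<in>M. conf z w" using \<open>R = {}\<close> unfolding R_def by blast
    then show "\<exists>w\<in>M. conf z w \<and> r z \<le> 2 * r w" using M \<open>z \<in> Z\<close> unfolding \<F>_def by blast
  qed (use M in \<open>auto simp: \<F>_def\<close>)
qed

lemma diameter_cball_le:
  fixes z :: "'a::metric_space"
  assumes "0 < r"
  shows "diameter (cball z r) \<le> 2 * r"
proof -
  have "dist p q \<le> 2 * r" if "p \<in> cball z r" "q \<in> cball z r" for p q
    using that dist_triangle3[of p q z] by simp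
  moreover have "cball z r \<noteq> {}" using assms by simp
  ultimately show ?thesis by (auto simp del: cball_eq_empty mem_cball simp: diameter_def intro!: cSUP_least)
qed

lemma hausdorff_weight_cball_le:
  fixes z :: "'a::metric_space"
  assumes "0 < r"
  shows "hausdorff_weight (real k) (cball z r) \<le> ennreal (unit_ball_vol (real k) * r ^ k)"
proof (rule hausdorff_weight_le[OF _ assms])
  show "dist p q \<le> 2 * r" if "p \<in> cball z r" "q \<in> cball z r" for p q
    using that dist_triangle3[of p q z] by simp
qed

text \<open>
  If the cardinalities of the finite \<open>s\<close>-separated subsets of \<open>S\<close> are bounded, a largest one is an
  \<open>s\<close>-net and yields a cover of \<open>S\<close> by balls; otherwise the cardinality alone can be made large enough.
\<close>

lemma separated_subset_of_hausdorff_delta: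
  fixes S :: "'a::metric_space set"
  assumes a: "ennreal a < hausdorff_delta (real k) \<delta> S" and s: "0 < s" "2 * s \<le> \<delta>"
  obtains X where "finite X" "X \<subseteq> S" "\<And>x y. x \<in> X \<Longrightarrow> y \<in> X \<Longrightarrow> x \<noteq> y \<Longrightarrow> s < dist x y"
    "a \<le> real (card X) * (unit_ball_vol (real k) * s ^ k)"
proof -
  define \<X> where "\<X> = {X. finite X \<and> X \<subseteq> S \<and> (\<forall>x\<in>X. \<forall>y\<in>X. x \<noteq> y \<longrightarrow> s < dist x y)}"
  let ?w = "unit_ball_vol (real k) * s ^ k"
  have w: "0 < ?w" using s by simp
  have "\<exists>X\<in>\<X>. a \<le> real (card X) * ?w"
  proof (cases "\<exists>N. \<forall>X\<in>\<X>. card X < N")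
    case True
    then obtain N where N: "\<And>X. X \<in> \<X> \<Longrightarrow> card X < N" by blast
    have "{} \<in> \<X>" by (simp add: \<X>_def)
    from ex_has_greatest_nat[of "\<lambda>X. X \<in> \<X>" "{}" card N, OF this] N
    obtain X where X: "X \<in> \<X>" and max: "\<And>Y. Y \<in> \<X> \<Longrightarrow> card Y \<le> card X" by (auto intro: less_imp_le)
    have fin: "finite X" using X by (simp add: \<X>_def)
    have cov: "S \<subseteq> (\<Union>x\<in>X. cball x s)"
    proof (rule subsetI, rule ccontr)
      fix y assume y: "y \<in> S" "y \<notin> (\<Union>x\<in>X. cball x s)"
      then have far: "s < dist x y" "s < dist y x" if "x \<in> X" for x
        using that by (auto simp: not_le dist_commute)
      then have "insert y X \<in> \<X>" using X y(1) unfolding \<X>_def by auto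
      moreover have "y \<notin> X" using far s(1) by fastforce
      ultimately show False using max[of "insert y X"] fin by simp
    qed
    have "hausdorff_delta (real k) \<delta> S \<le> ennreal (real (card X) * ?w)"
    proof (rule hausdorff_delta_le_of_countable_cover[OF _ cov])
      show "countable X" using fin by (rule countable_finite)
      show "0 < \<delta>" using s by simp
      show "diameter (cball x s) \<le> \<delta>" for x :: 'a
        using diameter_cball_le[OF s(1), of x] s(2) by simp
      fix F assume F: "finite F" "F \<subseteq> X"
      have "(\<Sum>x\<in>F. hausdorff_weight (real k) (cball x s)) \<le> (\<Sum>x\<in>F. ennreal ?w)"
        using s(1) by (intro sum_mono hausdorff_weight_cball_le)
      also have "\<dots> = ennreal (real (card F) * ?w)"
        using w by (simp add: ennreal_mult ennreal_of_nat_eq_real_of_nat)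
      also have "\<dots> \<le> ennreal (real (card X) * ?w)"
        using F fin w by (intro ennreal_leI mult_right_mono) (auto intro: card_mono)
      finally show "(\<Sum>x\<in>F. hausdorff_weight (real k) (cball x s)) \<le> ennreal (real (card X) * ?w)" .
    qed auto
    then have "ennreal a \<le> ennreal (real (card X) * ?w)" using a by simp
    then have "a \<le> real (card X) * ?w" using w by (subst (asm) ennreal_le_iff) simp_all
    then show ?thesis using X by blast
  next
    case False
    obtain N :: nat where N: "a / ?w < real N" using reals_Archimedean2 by blast
    obtain X where "X \<in> \<X>" "N \<le> card X" using False by (meson not_le)
    moreover have "a \<le> real (card X) * ?w"
    proof -
      have "a < real N * ?w" using N w by (simp only: pos_divide_less_eq)
      also have "\<dots> \<le> real (card X) * ?w" using \<open>N \<le> card X\<close> w by (intro mult_right_mono) auto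
      finally show ?thesis by simp
    qed
    ultimately show ?thesis by blast
  qed
  then obtain X where X: "X \<in> \<X>" "a \<le> real (card X) * ?w" by blast
  show ?thesis using X by (intro that[of X]) (simp_all add: \<X>_def)
qed

context lipschitz_pseudometric
begin

text \<open>
  Points near \<open>x\<close> at which the underlying map is close to its value at \<open>x\<close>; the radius is \<open>K\<close>
  times larger in the domain than the tolerance, measured in units of \<open>L\<close>, in the target.
\<close>

definition near_fibre :: "real \<Rightarrow> real \<Rightarrow> 'a \<Rightarrow> 'a set" where
  "near_fibre K \<rho> x = {y \<in> cball x (K * \<rho>). D x y \<le> L * \<rho>}"

lemma near_fibre_lmeasurable: "near_fibre K \<rho> x \<in> lmeasurable"
proof -
  have eq: "near_fibre K \<rho> x = cball x (K * \<rho>) \<inter> {y. D x y \<le> L * \<rho>}" by (auto simp: near_fibre_def)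
  have "closed {y. D x y \<le> L * \<rho>}"
    by (intro closed_Collect_le continuous_on_D continuous_intros)
  then show ?thesis unfolding eq by (intro lmeasurable_compact compact_Int_closed compact_cball)
qed

text \<open>
  Upper semicontinuity of the volume: the upper limit of \<open>near_fibre K \<rho> (X n)\<close> along a convergent
  sequence \<open>X\<close> is contained in \<open>near_fibre K \<rho> x\<close>, and all these sets lie in a common ball.
\<close>

lemma closed_measure_near_fibre_ge: "closed {x. c \<le> measure lebesgue (near_fibre K \<rho> x)}"
  unfolding closed_sequential_limits
proof (intro allI impI, elim conjE)
  fix X x assume X: "\<forall>n. X n \<in> {x. c \<le> measure lebesgue (near_fibre K \<rho> x)}" and lim: "X \<longlonglongrightarrow> x"
  define U where "U n = (\<Union>j\<in>{n..}. near_fibre K \<rho> (X j))" for n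
  obtain b where b: "\<And>n. norm (X n) \<le> b"
    using lim Bseq_def convergent_imp_Bseq convergentI by metis
  have Usub: "U n \<subseteq> cball 0 (b + K * \<rho>)" for n
  proof
    fix y assume "y \<in> U n"
    then obtain j where "dist (X j) y \<le> K * \<rho>" by (auto simp: U_def near_fibre_def)
    then show "y \<in> cball 0 (b + K * \<rho>)"
      using b[of j] norm_triangle_sub[of y "X j"] by (simp add: dist_norm norm_minus_commute)
  qed
  have Umeas: "U n \<in> sets lebesgue" for n
    unfolding U_def by (intro sets.countable_UN'' fmeasurableD near_fibre_lmeasurable) auto
  have Ulm: "U n \<in> lmeasurable" for n
    using lmeasurable_cball Usub Umeas by (rule fmeasurableI2)
  have "c \<le> measure lebesgue (U n)" for n
  proof -
    have "c \<le> measure lebesgue (near_fibre K \<rho> (X n))" using X by simp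
    also have "\<dots> \<le> measure lebesgue (U n)"
      by (rule measure_mono_fmeasurable[OF _ fmeasurableD[OF near_fibre_lmeasurable] Ulm]) (auto simp: U_def)
    finally show ?thesis .
  qed
  moreover have "(\<lambda>n. measure lebesgue (U n)) \<longlonglongrightarrow> measure lebesgue (\<Inter>n. U n)"
  proof (rule Lim_measure_decseq)
    show "range U \<subseteq> sets lebesgue" using Umeas by blast
    show "decseq U" unfolding U_def decseq_def by (auto intro: order_trans)
    show "emeasure lebesgue (U i) \<noteq> \<infinity>" for i using fmeasurableD2[OF Ulm] by simp
  qed
  ultimately have "c \<le> measure lebesgue (\<Inter>n. U n)"
    by (intro LIMSEQ_le_const) auto
  also have "\<dots> \<le> measure lebesgue (near_fibre K \<rho> x)"
  proof (rule measure_mono_fmeasurable)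
    show "(\<Inter>n. U n) \<subseteq> near_fibre K \<rho> x"
    proof
      fix y assume y: "y \<in> (\<Inter>n. U n)"
      have close: "dist x y \<le> K * \<rho> + e \<and> D x y \<le> L * \<rho> + L * e" if "0 < e" for e
      proof -
        obtain n where n: "\<And>j. n \<le> j \<Longrightarrow> dist (X j) x < e"
          using metric_LIMSEQ_D[OF lim \<open>0 < e\<close>] by blast
        have "y \<in> U n" using y by blast
        then obtain j where "n \<le> j" "dist (X j) y \<le> K * \<rho>" "D (X j) y \<le> L * \<rho>"
          by (auto simp: U_def near_fibre_def)
        moreover have "L * dist x (X j) \<le> L * e"
          using n[OF \<open>n \<le> j\<close>] L_pos by (simp add: dist_commute)
        ultimately show ?thesis
          using n[OF \<open>n \<le> j\<close>] dist_triangle2[of x y "X j"] D_move_left[of x y "X j"]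
          by (simp add: dist_commute)
      qed
      have "dist x y \<le> K * \<rho>" using close by (blast intro: field_le_epsilon)
      moreover have "D x y \<le> L * \<rho>"
      proof (rule field_le_epsilon)
        fix e :: real assume "0 < e"
        then show "D x y \<le> L * \<rho> + e" using close[of "e / L"] L_pos by simp
      qed
      ultimately show "y \<in> near_fibre K \<rho> x" by (simp add: near_fibre_def)
    qed
    show "(\<Inter>n. U n) \<in> sets lebesgue" using Umeas by (intro sets.countable_INT'') auto
  qed (rule near_fibre_lmeasurable)
  finally show "x \<in> {x. c \<le> measure lebesgue (near_fibre K \<rho> x)}" by simp
qed


text \<open>
  The Eilenberg type inequality at the heart of the proof. For each value \<open>z\<close> with a large fibre one takes a
  finite subset \<open>X z\<close> of the fibre, separated at scale \<open>2 K \<rho>\<close>, with at least \<open>a / (\<omega>\<^sub>k (2 K \<rho>)\<^sup>k)\<close> points,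
  where \<open>\<omega>\<^sub>k\<close> is the volume of the unit ball; the disjoint sets
  \<open>near_fibre K \<rho> x\<close> for \<open>x\<close> in \<open>X z\<close> form a set \<open>U z\<close> of volume at least \<open>c \<rho>\<^sup>m\<close>. If \<open>U z\<close> and \<open>U w\<close> meet, then
  \<open>dist z w\<close> is at most \<open>L\<close> times the sum of the two scales. So a Vitali selection yields values \<open>z\<close> with disjoint sets
  \<open>U z\<close> inside \<open>V\<close> such that the balls of radius \<open>3 L \<rho> z\<close> cover all values in question.
\<close>

lemma hausdorff_measure_fat_fibres:
  fixes f :: "'a \<Rightarrow> 'x::metric_space"
  assumes f: "\<And>x y. x \<in> A \<Longrightarrow> y \<in> A \<Longrightarrow> dist (f x) (f y) = D x y"
    and km: "k + m = DIM('a)" and V: "V \<in> lmeasurable" "open V" and E: "E \<subseteq> A" "E \<subseteq> V"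
    and pos: "0 < K" "0 < N" "0 < a"
    and fat: "\<And>x. x \<in> E \<Longrightarrow> \<exists>r>0. \<forall>\<rho>. 0 < \<rho> \<and> \<rho> < r \<longrightarrow>
      N * \<rho> ^ DIM('a) \<le> measure lebesgue (near_fibre K \<rho> x)"
  shows "hausdorff_measure (real m) {z. ennreal a < hausdorff_measure (real k) {x \<in> E. f x = z}}
    \<le> ennreal (unit_ball_vol (real m) * (3 * L) ^ m *
        (unit_ball_vol (real k) * (2 * K) ^ k) / (a * N) * measure lebesgue V)" (is "_ \<le> ennreal ?B")
proof -
  let ?n = "DIM('a)" and ?\<mu> = "measure lebesgue" and ?W = "near_fibre K"
  let ?Z = "{z. ennreal a < hausdorff_measure (real k) {x \<in> E. f x = z}}"
  define wk where "wk = unit_ball_vol (real k) * (2 * K) ^ k"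
  define wm where "wm = unit_ball_vol (real m) * (3 * L) ^ m"
  define c where "c = a * N / wk"
  have w: "0 < wk" "0 < wm" "0 < c" using pos L_pos by (simp_all add: wk_def wm_def c_def)
  have B: "?B = wm / c * ?\<mu> V" using w pos by (simp add: wk_def wm_def c_def)
  define C where "C i = {x. ball x (1 / real (Suc i)) \<subseteq> V \<and>
      (\<forall>\<rho>. 0 < \<rho> \<and> \<rho> < 1 / real (Suc i) \<longrightarrow> N * \<rho> ^ ?n \<le> ?\<mu> (?W \<rho> x))}" for i :: nat
  have C_closed: "closed (C i)" for i
  proof -
    have "C i = (\<Inter>y\<in>- V. {x. 1 / real (Suc i) \<le> dist x y}) \<inter>
        (\<Inter>\<rho>\<in>{0<..<1 / real (Suc i)}. {x. N * \<rho> ^ ?n \<le> ?\<mu> (?W \<rho> x)})"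
      unfolding C_def by (auto simp: not_le[symmetric] subset_iff)
    then show ?thesis
      by (simp only:) (intro closed_Int closed_INT ballI closed_measure_near_fibre_ge
        closed_Collect_le continuous_intros)
  qed
  have small: "1 / real (Suc j) \<le> 1 / real (Suc i)" if "i \<le> j" for i j
    using that by (simp add: frac_le)
  have C_inc: "incseq C"
  proof (rule monoI)
    fix i j :: nat assume "i \<le> j"
    then have le: "1 / real (Suc j) \<le> 1 / real (Suc i)" by (rule small)
    show "C i \<subseteq> C j"
    proof
      fix x assume x: "x \<in> C i"
      have "ball x (1 / real (Suc j)) \<subseteq> ball x (1 / real (Suc i))" using le by (rule subset_ball)
      then have "ball x (1 / real (Suc j)) \<subseteq> V" using x unfolding C_def by blast
      moreover have "N * \<rho> ^ ?n \<le> ?\<mu> (?W \<rho> x)" if "0 < \<rho> \<and> \<rho> < 1 / real (Suc j)" for \<rho>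
        using x that le unfolding C_def by simp
      ultimately show "x \<in> C j" unfolding C_def by blast
    qed
  qed
  have E_C: "E \<subseteq> (\<Union>i. C i)"
  proof
    fix x assume x: "x \<in> E"
    obtain e where e: "e > 0" "ball x e \<subseteq> V" using V(2) x E(2) by (meson openE subsetD)
    obtain r where r: "r > 0" "\<And>\<rho>. 0 < \<rho> \<Longrightarrow> \<rho> < r \<Longrightarrow> N * \<rho> ^ ?n \<le> ?\<mu> (?W \<rho> x)"
      using fat[OF x] by blast
    have "0 < min e r" using e r by simp
    then obtain i where "inverse (real (Suc i)) < min e r" using reals_Archimedean by blast
    then have i: "1 / real (Suc i) < e" "1 / real (Suc i) < r" by (auto simp: inverse_eq_divide)
    have "ball x (1 / real (Suc i)) \<subseteq> V" using e(2) i(1) subset_ball[of "1 / real (Suc i)" e x] by auto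
    moreover have "N * \<rho> ^ ?n \<le> ?\<mu> (?W \<rho> x)" if "0 < \<rho> \<and> \<rho> < 1 / real (Suc i)" for \<rho>
      using r(2)[of \<rho>] that i(2) by simp
    ultimately have "x \<in> C i" unfolding C_def by blast
    then show "x \<in> (\<Union>i. C i)" by blast
  qed
  have "hausdorff_delta (real m) \<delta> ?Z \<le> ennreal ?B" if "0 < \<delta>" for \<delta>
  proof -
    define good where "good z \<rho> X \<longleftrightarrow> 0 < \<rho> \<and> \<rho> \<le> 1 \<and> 6 * L * \<rho> \<le> \<delta> \<and> finite X \<and> X \<subseteq> {x \<in> E. f x = z} \<and>
        (\<forall>x\<in>X. \<forall>y\<in>X. x \<noteq> y \<longrightarrow> 2 * K * \<rho> < dist x y) \<and> a \<le> real (card X) * (wk * \<rho> ^ k) \<and>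
        (\<forall>x\<in>X. ?W \<rho> x \<subseteq> V \<and> N * \<rho> ^ ?n \<le> ?\<mu> (?W \<rho> x))" for z \<rho> X
    have ex: "\<exists>p. good z (fst p) (snd p)" if z: "z \<in> ?Z" for z
    proof -
      let ?S = "{x \<in> E. f x = z}"
      have "?S \<subseteq> (\<Union>i. C i)" using E_C by blast
      from hausdorff_measure_closed_exhaustion[OF C_closed C_inc this] z
      obtain i where i: "ennreal a < hausdorff_measure (real k) (?S \<inter> C i)" by blast
      then obtain \<epsilon> where \<epsilon>: "0 < \<epsilon>" "ennreal a < hausdorff_delta (real k) \<epsilon> (?S \<inter> C i)"
        unfolding hausdorff_measure_def by (auto simp: less_SUP_iff)
      define \<eta> where "\<eta> = 1 / real (Suc i)"
      have "0 < \<eta>" by (simp add: \<eta>_def)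
      \<comment> \<open>in this order: a common bound on the radii for the selection, the mesh \<open>\<delta>\<close> of the cover in the target, \<open>\<rho> < \<eta>\<close> for the volume bound, \<open>K \<rho> < \<eta>\<close> to stay inside \<open>V\<close>, and the mesh \<open>\<epsilon>\<close> for the packing of the fibre\<close>
      define \<rho> where "\<rho> = Min {1, \<delta> / (6 * L), \<eta> / 2, \<eta> / (2 * K), \<epsilon> / (4 * K)}"
      have \<rho>: "0 < \<rho>" using \<open>0 < \<delta>\<close> \<open>0 < \<epsilon>\<close> \<open>0 < \<eta>\<close> pos L_pos by (simp add: \<rho>_def)
      have \<rho>_le: "\<rho> \<le> 1" "\<rho> \<le> \<delta> / (6 * L)" "\<rho> \<le> \<eta> / 2" "\<rho> \<le> \<eta> / (2 * K)" "\<rho> \<le> \<epsilon> / (4 * K)"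
        by (simp_all add: \<rho>_def)
      have "6 * L * \<rho> \<le> \<delta>" using \<rho>_le(2) L_pos by (simp add: field_simps)
      have "\<rho> < \<eta>" using \<rho>_le(3) \<open>0 < \<eta>\<close> by simp
      have "2 * (K * \<rho>) \<le> \<eta>" using \<rho>_le(4) pos(1) by (simp add: field_simps)
      then have "K * \<rho> < \<eta>" using \<rho> pos(1) mult_pos_pos[of K \<rho>] by linarith
      have "2 * (2 * K * \<rho>) \<le> \<epsilon>" using \<rho>_le(5) pos(1) by (simp add: field_simps)
      moreover have "0 < 2 * K * \<rho>" using \<rho> pos(1) by simp
      ultimately obtain X where X: "finite X" "X \<subseteq> ?S \<inter> C i"
          "\<And>x y. x \<in> X \<Longrightarrow> y \<in> X \<Longrightarrow> x \<noteq> y \<Longrightarrow> 2 * K * \<rho> < dist x y"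
          "a \<le> real (card X) * (unit_ball_vol (real k) * (2 * K * \<rho>) ^ k)"
        using separated_subset_of_hausdorff_delta[OF \<epsilon>(2)] by blast
      have "a \<le> real (card X) * (wk * \<rho> ^ k)"
        using X(4) by (simp add: wk_def power_mult_distrib mult.assoc)
      moreover have "?W \<rho> x \<subseteq> V \<and> N * \<rho> ^ ?n \<le> ?\<mu> (?W \<rho> x)" if "x \<in> X" for x
      proof
        have "x \<in> C i" using X(2) that by blast
        then have "ball x \<eta> \<subseteq> V" and le: "\<And>\<rho>. 0 < \<rho> \<Longrightarrow> \<rho> < \<eta> \<Longrightarrow> N * \<rho> ^ ?n \<le> ?\<mu> (?W \<rho> x)"
          unfolding C_def \<eta>_def by blast+
        moreover have "?W \<rho> x \<subseteq> ball x \<eta>" using \<open>K * \<rho> < \<eta>\<close> by (auto simp: near_fibre_def)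
        ultimately show "?W \<rho> x \<subseteq> V" by blast
        show "N * \<rho> ^ ?n \<le> ?\<mu> (?W \<rho> x)" using le \<rho> \<open>\<rho> < \<eta>\<close> by blast
      qed
      ultimately have "good z \<rho> X"
        unfolding good_def using \<rho> \<rho>_le(1) \<open>6 * L * \<rho> \<le> \<delta>\<close> X(1,2,3) by blast
      then have "good z (fst (\<rho>, X)) (snd (\<rho>, X))" by simp
      then show ?thesis by (rule exI)
    qed
    then have "\<forall>z\<in>?Z. \<exists>p. good z (fst p) (snd p)" by (rule ballI)
    from bchoice[OF this] obtain g where g: "\<And>z. z \<in> ?Z \<Longrightarrow> good z (fst (g z)) (snd (g z))" by blast
    define \<rho> where "\<rho> z = fst (g z)" for z
    define X where "X z = snd (g z)" for z
    define U where "U z = (\<Union>x\<in>X z. ?W (\<rho> z) x)" for z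
    have good: "good z (\<rho> z) (X z)" if "z \<in> ?Z" for z using g[OF that] by (simp add: \<rho>_def X_def)
    have \<rho>: "0 < \<rho> z" "\<rho> z \<le> 1" "6 * L * \<rho> z \<le> \<delta>" if "z \<in> ?Z" for z
      using good[OF that] unfolding good_def by blast+
    have X: "finite (X z)" "X z \<subseteq> {x \<in> E. f x = z}" "\<And>x y. x \<in> X z \<Longrightarrow> y \<in> X z \<Longrightarrow> x \<noteq> y \<Longrightarrow> 2 * K * \<rho> z < dist x y"
        "a \<le> real (card (X z)) * (wk * \<rho> z ^ k)"
        "\<And>x. x \<in> X z \<Longrightarrow> ?W (\<rho> z) x \<subseteq> V" "\<And>x. x \<in> X z \<Longrightarrow> N * \<rho> z ^ ?n \<le> ?\<mu> (?W (\<rho> z) x)"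
      if "z \<in> ?Z" for z
      using good[OF that] unfolding good_def by blast+
    have U_meas: "U z \<in> lmeasurable" if "z \<in> ?Z" for z
      unfolding U_def by (intro fmeasurable.finite_UN X(1)[OF that] near_fibre_lmeasurable)
    have U_V: "U z \<subseteq> V" if "z \<in> ?Z" for z unfolding U_def using X(5)[OF that] by blast
    have U_large: "c * \<rho> z ^ m \<le> ?\<mu> (U z)" if z: "z \<in> ?Z" for z
    proof -
      have "c * \<rho> z ^ m \<le> (real (card (X z)) * (wk * \<rho> z ^ k)) * N / wk * \<rho> z ^ m"
        unfolding c_def using X(4)[OF z] w pos \<rho>(1)[OF z]
        by (intro mult_right_mono divide_right_mono) auto
      also have "\<dots> = real (card (X z)) * (N * \<rho> z ^ ?n)"
        using w km by (simp flip: km add: power_add)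
      also have "\<dots> = (\<Sum>x\<in>X z. N * \<rho> z ^ ?n)" by simp
      also have "\<dots> \<le> (\<Sum>x\<in>X z. ?\<mu> (?W (\<rho> z) x))" by (intro sum_mono X(6)[OF z])
      also have "\<dots> = ?\<mu> (U z)"
        unfolding U_def
      proof (rule measure_UNION'[symmetric, OF X(1)[OF z] near_fibre_lmeasurable])
        have "disjnt (?W (\<rho> z) x) (?W (\<rho> z) y)" if "x \<in> X z" "y \<in> X z" "x \<noteq> y" for x y
        proof -
          have "2 * K * \<rho> z < dist x y" using X(3)[OF z that] .
          moreover have "dist x y \<le> 2 * K * \<rho> z" if "p \<in> ?W (\<rho> z) x" "p \<in> ?W (\<rho> z) y" for p
            using that dist_triangle2[of x y p] by (simp add: near_fibre_def)
          ultimately show ?thesis unfolding disjnt_iff by (metis not_le)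
        qed
        then show "pairwise (\<lambda>x y. disjnt (?W (\<rho> z) x) (?W (\<rho> z) y)) (X z)" by (simp add: pairwise_def)
      qed
      finally show ?thesis .
    qed
    define conf where "conf z w \<longleftrightarrow> dist z w \<le> L * (\<rho> z + \<rho> w)" for z w
    obtain Y where Y: "Y \<subseteq> ?Z" "\<And>z w. z \<in> Y \<Longrightarrow> w \<in> Y \<Longrightarrow> conf z w \<Longrightarrow> z = w"
        "\<And>z. z \<in> ?Z \<Longrightarrow> \<exists>w\<in>Y. conf z w \<and> \<rho> z \<le> 2 * \<rho> w"
    proof (rule independent_selection[of ?Z conf \<rho> 1])
      show "conf z z" if "z \<in> ?Z" for z using \<rho>(1)[OF that] L_pos by (simp add: conf_def)
      show "conf w z" if "conf z w" for z w using that by (simp add: conf_def dist_commute add.commute)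
    qed (use \<rho>(1,2) in blast)+
    have disj: "disjnt (U z) (U w)" if zw: "z \<in> Y" "w \<in> Y" "z \<noteq> w" for z w
      unfolding disjnt_iff
    proof (intro allI notI, elim conjE)
      fix p assume "p \<in> U z" "p \<in> U w"
      then obtain x y where xy: "x \<in> X z" "p \<in> ?W (\<rho> z) x" "y \<in> X w" "p \<in> ?W (\<rho> w) y"
        unfolding U_def by blast
      have "z \<in> ?Z" "w \<in> ?Z" using zw Y(1) by blast+
      then have "x \<in> A" "y \<in> A" "f x = z" "f y = w" using X(2)[of z] X(2)[of w] xy E by blast+
      then have "dist z w = D x y" using f by blast
      also have "\<dots> \<le> D x p + D y p" using D_triangle[of x y p] D_sym[of p y] by simp
      also have "\<dots> \<le> L * (\<rho> z + \<rho> w)" using xy by (simp add: near_fibre_def distrib_left)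
      finally show False using Y(2)[of z w] zw by (simp add: conf_def)
    qed
    have fin: "(\<Sum>z\<in>F. c * \<rho> z ^ m) \<le> ?\<mu> V" if F: "finite F" "F \<subseteq> Y" for F
    proof -
      have FZ: "z \<in> ?Z" if "z \<in> F" for z using that F Y(1) by blast
      have "(\<Sum>z\<in>F. c * \<rho> z ^ m) \<le> (\<Sum>z\<in>F. ?\<mu> (U z))" by (intro sum_mono U_large FZ)
      also have "\<dots> = ?\<mu> (\<Union>z\<in>F. U z)"
      proof (rule measure_UNION'[symmetric, OF F(1)])
        show "pairwise (\<lambda>x y. disjnt (U x) (U y)) F" using disj F(2) by (auto simp: pairwise_def)
      qed (intro U_meas FZ)
      also have "\<dots> \<le> ?\<mu> V"
      proof (rule measure_mono_fmeasurable)
        show "(\<Union>z\<in>F. U z) \<subseteq> V" using U_V FZ by blast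
        show "(\<Union>z\<in>F. U z) \<in> sets lebesgue" by (intro fmeasurableD fmeasurable.finite_UN F(1) U_meas FZ)
      qed (rule V(1))
      finally show ?thesis .
    qed
    have Ypos: "0 < c * \<rho> z ^ m" if "z \<in> Y" for z using \<rho>(1)[of z] Y(1) that w by auto
    have "countable Y"
    proof -
      have "(\<lambda>z. c * \<rho> z ^ m) summable_on Y"
        using Ypos fin by (intro nonneg_bounded_partial_sums_imp_summable_on[where C = "?\<mu> V"]
          eventually_finite_subsets_at_top_weakI) (auto intro: less_imp_le)
      then have "countable {z \<in> Y. c * \<rho> z ^ m \<noteq> 0}" by (rule summable_countable_real)
      moreover have "c * \<rho> z ^ m \<noteq> 0" if "z \<in> Y" for z
        using Ypos[OF that] by (rule less_imp_neq[THEN not_sym])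
      then have "{z \<in> Y. c * \<rho> z ^ m \<noteq> 0} = Y" by blast
      ultimately show ?thesis by simp
    qed
    then show ?thesis
    proof (rule hausdorff_delta_le_of_countable_cover)
      show "?Z \<subseteq> (\<Union>z\<in>Y. cball z (3 * L * \<rho> z))"
      proof
        fix z assume "z \<in> ?Z"
        then obtain w where w: "w \<in> Y" "conf z w" "\<rho> z \<le> 2 * \<rho> w" using Y(3) by blast
        have "dist w z \<le> L * (\<rho> z + \<rho> w)" using w(2) by (simp add: conf_def dist_commute)
        also have "\<dots> \<le> L * (3 * \<rho> w)" using w(3) L_pos by (intro mult_left_mono) auto
        finally show "z \<in> (\<Union>z\<in>Y. cball z (3 * L * \<rho> z))" using w(1) by (intro UN_I[of w]) auto
      qed
      show "diameter (cball z (3 * L * \<rho> z)) \<le> \<delta>" if "z \<in> Y" for z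
      proof -
        have "0 < 3 * L * \<rho> z" using \<rho>(1)[of z] Y(1) that L_pos by auto
        then have "diameter (cball z (3 * L * \<rho> z)) \<le> 2 * (3 * L * \<rho> z)"
          by (rule diameter_cball_le)
        also have "\<dots> \<le> \<delta>" using \<rho>(3)[of z] Y(1) that by auto
        finally show ?thesis .
      qed
      fix F assume F: "finite F" "F \<subseteq> Y"
      have "(\<Sum>z\<in>F. hausdorff_weight (real m) (cball z (3 * L * \<rho> z))) \<le> (\<Sum>z\<in>F. ennreal (wm / c * (c * \<rho> z ^ m)))"
      proof (rule sum_mono)
        fix z assume "z \<in> F"
        then have "0 < 3 * L * \<rho> z" using \<rho>(1)[of z] Y(1) F L_pos by auto
        then have "hausdorff_weight (real m) (cball z (3 * L * \<rho> z)) \<le> ennreal (unit_ball_vol (real m) * (3 * L * \<rho> z) ^ m)"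
          by (rule hausdorff_weight_cball_le)
        also have "unit_ball_vol (real m) * (3 * L * \<rho> z) ^ m = wm / c * (c * \<rho> z ^ m)"
          using w by (simp add: wm_def power_mult_distrib)
        finally show "hausdorff_weight (real m) (cball z (3 * L * \<rho> z)) \<le> ennreal (wm / c * (c * \<rho> z ^ m))" .
      qed
      also have "\<dots> = ennreal (\<Sum>z\<in>F. wm / c * (c * \<rho> z ^ m))"
      proof (rule sum_ennreal)
        fix z assume "z \<in> F"
        then have "0 < c * \<rho> z ^ m" using Ypos F(2) by blast
        moreover have "0 < wm / c" using w by simp
        ultimately show "0 \<le> wm / c * (c * \<rho> z ^ m)" by (intro mult_nonneg_nonneg[OF less_imp_le less_imp_le])
      qed
      also have "(\<Sum>z\<in>F. wm / c * (c * \<rho> z ^ m)) = wm / c * (\<Sum>z\<in>F. c * \<rho> z ^ m)"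
        by (rule sum_distrib_left[symmetric])
      also have "ennreal \<dots> \<le> ennreal ?B"
        unfolding B using fin[OF F] w by (intro ennreal_leI mult_left_mono) auto
      finally show "(\<Sum>z\<in>F. hausdorff_weight (real m) (cball z (3 * L * \<rho> z))) \<le> ennreal ?B" .
    qed (use \<open>0 < \<delta>\<close> in auto)
  qed
  then show ?thesis unfolding hausdorff_measure_def[of "real m"] by (auto intro!: SUP_least)
qed

end

section \<open>Singular points in almost every fibre\<close>

lemma hausdorff_measure_null_of_levels:
  assumes "\<And>a. 0 < a \<Longrightarrow> hausdorff_measure s {z. ennreal a < g z} = 0"
  shows "hausdorff_measure s {z. g z \<noteq> 0} = 0"
proof -
  have "hausdorff_measure s (\<Union>i. {z. ennreal (1 / real (Suc i)) < g z}) = 0"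
    by (intro hausdorff_measure_null_UN assms) simp
  moreover have "{z. g z \<noteq> 0} \<subseteq> (\<Union>i. {z. ennreal (1 / real (Suc i)) < g z})"
  proof
    fix z assume "z \<in> {z. g z \<noteq> 0}"
    then have "0 < g z" by (simp add: zero_less_iff_neq_zero)
    then obtain e where e: "0 < e" "ennreal e < g z"
    proof (cases "g z")
      case (real r)
      then have "0 < r" using \<open>0 < g z\<close> by (cases "r = 0") auto
      then show thesis using that[of "r / 2"] real by (simp add: ennreal_less_iff)
    next
      case top
      then show thesis using that[of 1] by simp
    qed
    obtain i where "inverse (real (Suc i)) < e" using reals_Archimedean[OF e(1)] by blast
    then have "ennreal (1 / real (Suc i)) \<le> ennreal e" by (intro ennreal_leI) (simp add: inverse_eq_divide)
    then show "z \<in> (\<Union>i. {z. ennreal (1 / real (Suc i)) < g z})"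
      using e(2) by (intro UN_I[of i]) (auto intro: le_less_trans)
  qed
  ultimately show ?thesis by (rule hausdorff_measure_null_subset)
qed

lemma ennreal_eq_0_of_bounds:
  assumes "\<And>e. 0 < e \<Longrightarrow> x \<le> ennreal (C * e)"
  shows "x = 0"
proof -
  have "x \<le> 0 + ennreal e" if "0 < e" for e
  proof -
    have "0 < e / (\<bar>C\<bar> + 1)" using that by simp
    from assms[OF this] have "x \<le> ennreal (C * (e / (\<bar>C\<bar> + 1)))" .
    also have "C * (e / (\<bar>C\<bar> + 1)) \<le> e"
    proof -
      have "C * e \<le> (\<bar>C\<bar> + 1) * e" using that by (intro mult_right_mono) auto
      then show ?thesis by (simp add: divide_le_eq mult.commute)
    qed
    finally show ?thesis by (simp add: ennreal_leI)
  qed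
  then have "x \<le> 0" by (rule ennreal_le_epsilon)
  then show ?thesis by simp
qed

context lipschitz_pseudometric
begin

text \<open>
  Here \<open>K = 1\<close>: the Lipschitz bound alone puts the whole ball of radius \<open>\<rho>\<close> into \<open>near_fibre 1 \<rho> x\<close>, and the open
  set around \<open>E\<close> can be taken arbitrarily small.
\<close>

lemma hausdorff_null_fibres_of_negligible:
  fixes f :: "'a \<Rightarrow> 'x::metric_space"
  assumes f: "\<And>x y. x \<in> A \<Longrightarrow> y \<in> A \<Longrightarrow> dist (f x) (f y) = D x y"
    and km: "k + m = DIM('a)" and E: "E \<subseteq> A" "negligible E"
  shows "hausdorff_measure (real m) {z. hausdorff_measure (real k) {x \<in> E. f x = z} \<noteq> 0} = 0"
proof (rule hausdorff_measure_null_of_levels)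
  fix a :: real assume "0 < a"
  define N where "N = measure lebesgue (ball (0::'a) 1)"
  have "0 < N" unfolding N_def using content_ball_pos[of 1 "0::'a"] by simp
  have fat: "N * \<rho> ^ DIM('a) \<le> measure lebesgue (near_fibre 1 \<rho> x)" if "0 < \<rho>" for \<rho> x
  proof -
    have "N * \<rho> ^ DIM('a) = measure lebesgue (ball x \<rho>)"
      using that content_ball_conv_unit_ball[of \<rho> x] by (simp add: N_def)
    also have "\<dots> \<le> measure lebesgue (near_fibre 1 \<rho> x)"
    proof (rule measure_mono_fmeasurable[OF _ _ near_fibre_lmeasurable])
      show "ball x \<rho> \<subseteq> near_fibre 1 \<rho> x"
      proof
        fix y assume "y \<in> ball x \<rho>"
        then have d: "dist x y \<le> \<rho>" by simp
        then have "L * dist x y \<le> L * \<rho>" using L_pos by simp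
        then show "y \<in> near_fibre 1 \<rho> x" using d D_le[of x y] by (simp add: near_fibre_def)
      qed
    qed simp
    finally show ?thesis .
  qed
  define C where "C = unit_ball_vol (real m) * (3 * L) ^ m * (unit_ball_vol (real k) * (2 * 1) ^ k) / (a * N)"
  show "hausdorff_measure (real m) {z. ennreal a < hausdorff_measure (real k) {x \<in> E. f x = z}} = 0"
  proof (rule ennreal_eq_0_of_bounds[where C = C])
    fix e :: real assume "0 < e"
    have null: "E \<in> null_sets lebesgue" using E(2) by (simp only: negligible_iff_null_sets)
    then obtain V where V: "open V" "E \<subseteq> V" "V - E \<in> lmeasurable" "emeasure lebesgue (V - E) < ennreal e"
      using sets_lebesgue_outer_open[of E e] \<open>0 < e\<close> by auto
    have Veq: "V = (V - E) \<union> E" using V(2) by blast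
    have Vm: "V \<in> lmeasurable"
      by (subst Veq) (intro fmeasurable.Un V(3) fmeasurableI_null_sets null)
    have "measure lebesgue V = measure lebesgue (V - E)"
      by (subst Veq) (rule measure_Un_null_set[OF fmeasurableD[OF V(3)] null])
    also have "\<dots> \<le> e" using V(3,4) \<open>0 < e\<close> by (simp add: emeasure_eq_measure2 ennreal_less_iff)
    finally have Ve: "measure lebesgue V \<le> e" .
    have "hausdorff_measure (real m) {z. ennreal a < hausdorff_measure (real k) {x \<in> E. f x = z}}
        \<le> ennreal (C * measure lebesgue V)"
      unfolding C_def
    proof (rule hausdorff_measure_fat_fibres[OF f km Vm V(1) E(1) V(2) _ \<open>0 < N\<close> \<open>0 < a\<close>])
      show "\<exists>r>0. \<forall>\<rho>. 0 < \<rho> \<and> \<rho> < r \<longrightarrow> N * \<rho> ^ DIM('a) \<le> measure lebesgue (near_fibre 1 \<rho> x)" for x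
        using fat by (intro exI[of _ 1]) simp
    qed simp_all
    also have "\<dots> \<le> ennreal (C * e)"
      using Ve L_pos \<open>0 < a\<close> \<open>0 < N\<close> unfolding C_def by (intro ennreal_leI mult_left_mono) simp_all
    finally show "hausdorff_measure (real m) {z. ennreal a < hausdorff_measure (real k) {x \<in> E. f x = z}}
        \<le> ennreal (C * e)" .
  qed
qed

text \<open>
  The points \<open>x + \<rho> p\<close>, where \<open>p\<close> runs through the integer combinations with coefficients below \<open>K\<close> of
  \<open>k + 1\<close> orthonormal null directions, are \<open>\<rho>\<close>-separated, and \<open>D\<close> is at most \<open>L \<rho> / 2\<close> between \<open>x\<close> and each of them. Hence
  the \<open>K\<^bsup>k+1\<^esup>\<close> balls of radius \<open>\<rho> / 2\<close> around them are disjoint and contained in the near fibre. Only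
  finitely many directions \<open>p\<close> occur, so one scale serves them all.
\<close>

lemma near_fibre_large_of_dim:
  assumes reg: "regular_point x" and dim: "k < dim (null_directions x)" and "0 < K"
  shows "\<exists>r>0. \<forall>\<rho>. 0 < \<rho> \<and> \<rho> < r \<longrightarrow>
    real K ^ Suc k * (measure lebesgue (ball (0::'a) 1) / 2 ^ DIM('a)) * \<rho> ^ DIM('a)
      \<le> measure lebesgue (near_fibre (real (K * Suc k + 1)) \<rho> x)"
proof -
  let ?V = "null_directions x"
  have V: "subspace ?V" using reg by (simp add: regular_point_def)
  obtain B0 where B0: "B0 \<subseteq> ?V" "pairwise orthogonal B0" "\<And>b. b \<in> B0 \<Longrightarrow> norm b = 1"
      "card B0 = dim ?V"
    using orthonormal_basis_subspace[OF V] by metis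
  obtain B where B: "B \<subseteq> B0" "card B = Suc k" "finite B"
    using obtain_subset_with_card_n[of "Suc k" B0] dim B0(4) by (metis Suc_leI)
  have BV: "b \<in> ?V" "norm b = 1" if "b \<in> B" for b using that B(1) B0(1,3) by blast+
  have orth: "b \<bullet> b' = (if b = b' then 1 else 0)" if "b \<in> B" "b' \<in> B" for b b'
  proof (cases "b = b'")
    case True
    then show ?thesis using BV(2)[OF that(1)] by (simp add: dot_square_norm)
  next
    case False
    then show ?thesis using B0(2) that B(1) by (auto simp: pairwise_def orthogonal_def)
  qed
  define I where "I = B \<rightarrow>\<^sub>E {..<K}"
  have I: "finite I" "card I = K ^ Suc k"
    using B by (simp_all add: I_def finite_PiE card_PiE del: power_Suc)
  define p where "p a = (\<Sum>b\<in>B. real (a b) *\<^sub>R b)" for a :: "'a \<Rightarrow> nat"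
  have pV: "p a \<in> ?V" for a unfolding p_def by (intro subspace_sum[OF V] subspace_scale[OF V] BV(1))
  have p_norm: "norm (p a) \<le> real (K * Suc k)" if "a \<in> I" for a
  proof -
    have "norm (p a) \<le> (\<Sum>b\<in>B. norm (real (a b) *\<^sub>R b))" unfolding p_def by (rule norm_sum)
    also have "\<dots> \<le> (\<Sum>b\<in>B. real K)"
    proof (rule sum_mono)
      fix b assume "b \<in> B"
      then have "a b < K" using that unfolding I_def by (meson PiE_mem lessThan_iff)
      then show "norm (real (a b) *\<^sub>R b) \<le> real K" using BV(2)[OF \<open>b \<in> B\<close>] by simp
    qed
    also have "\<dots> = real (K * Suc k)" using B(2) by (simp add: algebra_simps)
    finally show ?thesis .
  qed
  have p_inner: "p a \<bullet> b = real (a b)" if "b \<in> B" for a b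
  proof -
    have "p a \<bullet> b = (\<Sum>b'\<in>B. real (a b') * (b' \<bullet> b))" by (simp add: p_def inner_sum_left)
    also have "\<dots> = (\<Sum>b'\<in>B. if b' = b then real (a b') else 0)"
      using orth that by (intro sum.cong) auto
    also have "\<dots> = real (a b)" using B(3) that by simp
    finally show ?thesis .
  qed
  have p_far: "1 \<le> dist (p a) (p a')" if "a \<in> I" "a' \<in> I" "a \<noteq> a'" for a a'
  proof -
    have "\<exists>b\<in>B. a b \<noteq> a' b"
    proof (rule ccontr)
      assume "\<not> (\<exists>b\<in>B. a b \<noteq> a' b)"
      then have "a b = a' b" if "b \<in> B" for b using that by blast
      with \<open>a \<in> I\<close> \<open>a' \<in> I\<close> have "a = a'" unfolding I_def by (rule PiE_ext)
      with \<open>a \<noteq> a'\<close> show False ..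
    qed
    then obtain b where b: "b \<in> B" "a b \<noteq> a' b" by blast
    have "1 \<le> \<bar>real (a b) - real (a' b)\<bar>" using b(2) by linarith
    also have "\<dots> = \<bar>(p a - p a') \<bullet> b\<bar>" using p_inner[OF b(1)] by (simp add: inner_diff_left)
    also have "\<dots> \<le> norm (p a - p a') * norm b" by (rule Cauchy_Schwarz_ineq2)
    finally show ?thesis using BV(2)[OF b(1)] by (simp add: dist_norm)
  qed
  have "\<exists>r>0. \<forall>t. \<bar>t\<bar> < r \<longrightarrow> D x (x + t *\<^sub>R p a) \<le> L / 2 * \<bar>t\<bar>" for a
  proof -
    have "0 < L / 2" using L_pos by simp
    then have "upper_slope_le (L / 2) (p a) x" using pV[of a] unfolding null_directions_def by blast
    then show ?thesis unfolding upper_slope_le_def .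
  qed
  then have "\<forall>a. \<exists>r>0. \<forall>t. \<bar>t\<bar> < r \<longrightarrow> D x (x + t *\<^sub>R p a) \<le> L / 2 * \<bar>t\<bar>" by (rule allI)
  from choice[OF this] obtain R where R: "\<And>a. 0 < R a"
      "\<And>a t. \<bar>t\<bar> < R a \<Longrightarrow> D x (x + t *\<^sub>R p a) \<le> L / 2 * \<bar>t\<bar>" by blast
  define r where "r = Min (insert 1 (R ` I))"
  have r: "0 < r" "\<And>a. a \<in> I \<Longrightarrow> r \<le> R a" using I(1) R(1) by (simp_all add: r_def)
  show ?thesis
  proof (intro exI conjI allI impI)
    show "0 < r" by (rule r(1))
    fix \<rho> assume "0 < \<rho> \<and> \<rho> < r"
    then have \<rho>: "0 < \<rho>" "\<rho> < r" by auto
    let ?ball = "\<lambda>a. ball (x + \<rho> *\<^sub>R p a) (\<rho> / 2)"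
    have sub: "?ball a \<subseteq> near_fibre (real (K * Suc k + 1)) \<rho> x" if a: "a \<in> I" for a
    proof
      fix y assume "y \<in> ?ball a"
      then have y: "dist (x + \<rho> *\<^sub>R p a) y \<le> \<rho> / 2" by simp
      have "dist x (x + \<rho> *\<^sub>R p a) = \<rho> * norm (p a)" using \<rho> by (simp add: dist_norm)
      also have "\<dots> \<le> \<rho> * real (K * Suc k)" using p_norm[OF a] \<rho> by (intro mult_left_mono) auto
      finally have "dist x y \<le> \<rho> * real (K * Suc k) + \<rho>"
        using dist_triangle[of x y "x + \<rho> *\<^sub>R p a"] y \<rho> by linarith
      then have "dist x y \<le> real (K * Suc k + 1) * \<rho>" by (simp add: algebra_simps)
      moreover have "D x y \<le> L * \<rho>"
      proof -
        have "D x (x + \<rho> *\<^sub>R p a) \<le> L / 2 * \<rho>" using R(2)[of \<rho> a] r(2)[OF a] \<rho> by simp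
        moreover have "L * dist (x + \<rho> *\<^sub>R p a) y \<le> L * (\<rho> / 2)" using y L_pos by (intro mult_left_mono) auto
        ultimately show ?thesis using D_move_right[of x y "x + \<rho> *\<^sub>R p a"] by simp
      qed
      ultimately show "y \<in> near_fibre (real (K * Suc k + 1)) \<rho> x" by (simp add: near_fibre_def)
    qed
    have disj: "pairwise (\<lambda>a a'. disjnt (?ball a) (?ball a')) I"
    proof (rule pairwiseI)
      fix a a' assume "a \<in> I" "a' \<in> I" "a \<noteq> a'"
      then have "1 \<le> dist (p a) (p a')" by (rule p_far)
      then have "\<rho> * 1 \<le> \<rho> * dist (p a) (p a')" using \<rho> by (intro mult_left_mono) auto
      also have "\<dots> = dist (x + \<rho> *\<^sub>R p a) (x + \<rho> *\<^sub>R p a')"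
        using \<rho> by (simp add: dist_norm flip: scaleR_diff_right)
      finally have far: "\<rho> \<le> dist (x + \<rho> *\<^sub>R p a) (x + \<rho> *\<^sub>R p a')" by simp
      show "disjnt (?ball a) (?ball a')"
        unfolding disjnt_iff
      proof (intro allI notI, elim conjE)
        fix y assume "y \<in> ?ball a" "y \<in> ?ball a'"
        then show False
          using far dist_triangle2[of "x + \<rho> *\<^sub>R p a" "x + \<rho> *\<^sub>R p a'" y] by simp
      qed
    qed
    have vol: "measure lebesgue (?ball a) = measure lebesgue (ball (0::'a) 1) / 2 ^ DIM('a) * \<rho> ^ DIM('a)" for a
      using \<rho> content_ball_conv_unit_ball[of "\<rho> / 2" "x + \<rho> *\<^sub>R p a"] by (simp add: power_divide)
    have "real K ^ Suc k * (measure lebesgue (ball (0::'a) 1) / 2 ^ DIM('a)) * \<rho> ^ DIM('a)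
        = (\<Sum>a\<in>I. measure lebesgue (?ball a))"
      unfolding vol using I(2) by simp
    also have "\<dots> = measure lebesgue (\<Union>a\<in>I. ?ball a)"
      by (rule measure_UNION'[symmetric, OF I(1) _ disj]) simp
    also have "\<dots> \<le> measure lebesgue (near_fibre (real (K * Suc k + 1)) \<rho> x)"
    proof (rule measure_mono_fmeasurable[OF _ _ near_fibre_lmeasurable])
      show "(\<Union>a\<in>I. ?ball a) \<subseteq> near_fibre (real (K * Suc k + 1)) \<rho> x" using sub by blast
      show "(\<Union>a\<in>I. ?ball a) \<in> sets lebesgue" using I(1) by (intro sets.finite_UN) auto
    qed
    finally show "real K ^ Suc k * (measure lebesgue (ball (0::'a) 1) / 2 ^ DIM('a)) * \<rho> ^ DIM('a)
      \<le> measure lebesgue (near_fibre (real (K * Suc k + 1)) \<rho> x)" .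
  qed
qed

text \<open>
  The bound of \<open>hausdorff_measure_fat_fibres\<close> is proportional to
  \<open>(K (k + 1) + 1)\<^sup>k / K\<^bsup>k+1\<^esup> \<le> (k + 2)\<^sup>k / K\<close>, which tends to 0 as \<open>K\<close> grows.
\<close>

lemma hausdorff_null_fibres_of_dim:
  fixes f :: "'a \<Rightarrow> 'x::metric_space"
  assumes f: "\<And>x y. x \<in> A \<Longrightarrow> y \<in> A \<Longrightarrow> dist (f x) (f y) = D x y"
    and km: "k + m = DIM('a)" and E: "E \<subseteq> A" "bounded E"
    and dim: "\<And>x. x \<in> E \<Longrightarrow> regular_point x \<and> k < dim (null_directions x)"
  shows "hausdorff_measure (real m) {z. hausdorff_measure (real k) {x \<in> E. f x = z} \<noteq> 0} = 0"
proof (rule hausdorff_measure_null_of_levels)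
  fix a :: real assume "0 < a"
  define N where "N = measure lebesgue (ball (0::'a) 1) / 2 ^ DIM('a)"
  have "0 < N" unfolding N_def using content_ball_pos[of 1 "0::'a"] by simp
  obtain b where b: "E \<subseteq> ball 0 b" using bounded_subset_ballD[OF E(2)] by blast
  define C0 where "C0 = unit_ball_vol (real m) * (3 * L) ^ m * unit_ball_vol (real k) / (a * N) * measure lebesgue (ball (0::'a) b)"
  have "0 \<le> C0" unfolding C0_def using L_pos \<open>0 < a\<close> \<open>0 < N\<close> by simp
  show "hausdorff_measure (real m) {z. ennreal a < hausdorff_measure (real k) {x \<in> E. f x = z}} = 0"
  proof (rule ennreal_eq_0_of_bounds[where C = "C0 * (2 * (real k + 2)) ^ k"])
    fix e :: real assume "0 < e"
    obtain i where "inverse (real (Suc i)) < e" using reals_Archimedean[OF \<open>0 < e\<close>] by blast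
    define K where "K = Suc i"
    have K: "0 < K" "1 / real K \<le> e" using \<open>inverse (real (Suc i)) < e\<close> by (simp_all add: K_def inverse_eq_divide)
    let ?K = "real (K * Suc k + 1)"
    have "hausdorff_measure (real m) {z. ennreal a < hausdorff_measure (real k) {x \<in> E. f x = z}}
        \<le> ennreal (unit_ball_vol (real m) * (3 * L) ^ m * (unit_ball_vol (real k) * (2 * ?K) ^ k)
            / (a * (real K ^ Suc k * N)) * measure lebesgue (ball (0::'a) b))"
    proof (rule hausdorff_measure_fat_fibres[OF f km _ _ E(1) b _ _ \<open>0 < a\<close>])
      show "0 < ?K" by (subst of_nat_0_less_iff) simp
      show "0 < real K ^ Suc k * N" using K(1) \<open>0 < N\<close> by simp
      show "\<exists>r>0. \<forall>\<rho>. 0 < \<rho> \<and> \<rho> < r \<longrightarrow>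
          real K ^ Suc k * N * \<rho> ^ DIM('a) \<le> measure lebesgue (near_fibre ?K \<rho> x)" if "x \<in> E" for x
        using near_fibre_large_of_dim[of x k K] dim[OF that] K(1) unfolding N_def by blast
    qed simp_all
    also have "\<dots> \<le> ennreal (C0 * (2 * (real k + 2)) ^ k * e)"
    proof (rule ennreal_leI)
      have "?K \<le> (real k + 2) * real K" using K(1) by (simp add: algebra_simps)
      then have "(2 * ?K) ^ k \<le> (2 * ((real k + 2) * real K)) ^ k"
        by (intro power_mono mult_left_mono) auto
      also have "\<dots> = (2 * (real k + 2)) ^ k * real K ^ k"
        by (simp only: power_mult_distrib mult.assoc)
      finally have "(2 * ?K) ^ k / real K ^ Suc k \<le> (2 * (real k + 2)) ^ k * real K ^ k / real K ^ Suc k"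
        by (rule divide_right_mono) simp
      also have "\<dots> = (2 * (real k + 2)) ^ k * (1 / real K)" using K(1) by simp
      also have "\<dots> \<le> (2 * (real k + 2)) ^ k * e" using K(2) by (intro mult_left_mono) auto
      finally have "C0 * ((2 * ?K) ^ k / real K ^ Suc k) \<le> C0 * ((2 * (real k + 2)) ^ k * e)"
        using \<open>0 \<le> C0\<close> by (rule mult_left_mono)
      then show "unit_ball_vol (real m) * (3 * L) ^ m * (unit_ball_vol (real k) * (2 * ?K) ^ k)
            / (a * (real K ^ Suc k * N)) * measure lebesgue (ball (0::'a) b) \<le> C0 * (2 * (real k + 2)) ^ k * e"
        unfolding C0_def by (simp add: mult_ac)
    qed
    finally show "hausdorff_measure (real m) {z. ennreal a < hausdorff_measure (real k) {x \<in> E. f x = z}}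
        \<le> ennreal (C0 * (2 * (real k + 2)) ^ k * e)" .
  qed
qed

lemma hausdorff_null_singular_fibres:
  fixes f :: "'a \<Rightarrow> 'x::metric_space"
  assumes f: "\<And>x y. x \<in> A \<Longrightarrow> y \<in> A \<Longrightarrow> dist (f x) (f y) = D x y" and km: "k + m = DIM('a)"
  shows "hausdorff_measure (real m) {z. hausdorff_measure (real k)
    {x \<in> A. f x = z \<and> \<not> (regular_point x \<and> dim (null_directions x) \<le> k)} \<noteq> 0} = 0"
proof -
  \<comment> \<open>index 0 collects the null set; the others are bounded parts of the points with too many null directions\<close>
  define E where "E i = (if i = 0 then {x \<in> A. \<not> regular_point x}
      else {x \<in> A \<inter> ball 0 (real i). regular_point x \<and> k < dim (null_directions x)})" for i :: nat
  have null: "hausdorff_measure (real m) {z. hausdorff_measure (real k) {x \<in> E i. f x = z} \<noteq> 0} = 0" for i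
  proof (cases "i = 0")
    case True
    have "E 0 \<subseteq> A" "negligible (E 0)"
      by (auto simp: E_def intro: negligible_subset[OF negligible_not_regular_point])
    then show ?thesis using hausdorff_null_fibres_of_negligible[OF f km] True by blast
  next
    case False
    have "E i \<subseteq> A" "bounded (E i)" using False by (auto simp: E_def intro: bounded_subset[OF bounded_ball[of 0 "real i"]])
    then show ?thesis
      by (intro hausdorff_null_fibres_of_dim[OF f km]) (use False in \<open>auto simp: E_def\<close>)
  qed
  have "hausdorff_measure (real m) (\<Union>i. {z. hausdorff_measure (real k) {x \<in> E i. f x = z} \<noteq> 0}) = 0"
    by (intro hausdorff_measure_null_UN null)
  moreover have "{z. hausdorff_measure (real k)
        {x \<in> A. f x = z \<and> \<not> (regular_point x \<and> dim (null_directions x) \<le> k)} \<noteq> 0}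
      \<subseteq> (\<Union>i. {z. hausdorff_measure (real k) {x \<in> E i. f x = z} \<noteq> 0})"
  proof (rule subsetI, rule ccontr)
    fix z
    assume z: "z \<in> {z. hausdorff_measure (real k)
        {x \<in> A. f x = z \<and> \<not> (regular_point x \<and> dim (null_directions x) \<le> k)} \<noteq> 0}"
      and "z \<notin> (\<Union>i. {z. hausdorff_measure (real k) {x \<in> E i. f x = z} \<noteq> 0})"
    then have "hausdorff_measure (real k) {x \<in> E i. f x = z} = 0" for i by blast
    then have "hausdorff_measure (real k) (\<Union>i. {x \<in> E i. f x = z}) = 0" by (rule hausdorff_measure_null_UN)
    moreover have "{x \<in> A. f x = z \<and> \<not> (regular_point x \<and> dim (null_directions x) \<le> k)}
        \<subseteq> (\<Union>i. {x \<in> E i. f x = z})"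
    proof
      fix x assume x: "x \<in> {x \<in> A. f x = z \<and> \<not> (regular_point x \<and> dim (null_directions x) \<le> k)}"
      show "x \<in> (\<Union>i. {x \<in> E i. f x = z})"
      proof (cases "regular_point x")
        case True
        obtain i where i: "norm x < real i" using reals_Archimedean2 by blast
        then have "i \<noteq> 0" by (cases "i = 0") auto
        then have "x \<in> {x \<in> E i. f x = z}" using x True i by (simp add: E_def)
        then show ?thesis by blast
      next
        case False
        then have "x \<in> {x \<in> E 0. f x = z}" using x by (simp add: E_def)
        then show ?thesis by blast
      qed
    qed
    ultimately have "hausdorff_measure (real k)
        {x \<in> A. f x = z \<and> \<not> (regular_point x \<and> dim (null_directions x) \<le> k)} = 0"
      by (rule hausdorff_measure_null_subset)
    then show False using z by simp
  qed
  ultimately show ?thesis by (rule hausdorff_measure_null_subset)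
qed

end

section \<open>Lipschitz graphs in a fibre\<close>

text \<open>
  The norm of the image of \<open>v\<close> under the linear map into \<open>length bs\<close>-dimensional space whose coordinates are the inner
  products with the vectors in \<open>bs\<close>. Lists over a countable set form a countable family of such maps.
\<close>

definition coordinate_norm :: "'a::euclidean_space list \<Rightarrow> 'a \<Rightarrow> real" where
  "coordinate_norm bs v = L2_set (\<lambda>j. bs ! j \<bullet> v) {..<length bs}"

lemma coordinate_norm_scaleR: "coordinate_norm bs (t *\<^sub>R v) = \<bar>t\<bar> * coordinate_norm bs v"
proof -
  have "coordinate_norm bs (t *\<^sub>R v) = L2_set (\<lambda>j. \<bar>t\<bar> * \<bar>bs ! j \<bullet> v\<bar>) {..<length bs}"
    unfolding coordinate_norm_def L2_set_def by (simp add: power_mult_distrib)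
  also have "\<dots> = \<bar>t\<bar> * L2_set (\<lambda>j. \<bar>bs ! j \<bullet> v\<bar>) {..<length bs}" by (simp add: L2_set_right_distrib)
  also have "L2_set (\<lambda>j. \<bar>bs ! j \<bullet> v\<bar>) {..<length bs} = coordinate_norm bs v"
    by (simp add: coordinate_norm_def L2_set_def)
  finally show ?thesis .
qed

lemma coordinate_norm_nonneg: "0 \<le> coordinate_norm bs v"
  unfolding coordinate_norm_def by (rule L2_set_nonneg)

lemma tendsto_coordinate_norm:
  assumes "(u \<longlongrightarrow> v) F"
  shows "((\<lambda>i. coordinate_norm bs (u i)) \<longlongrightarrow> coordinate_norm bs v) F"
proof -
  have "((\<lambda>i. (bs ! j \<bullet> u i)\<^sup>2) \<longlongrightarrow> (bs ! j \<bullet> v)\<^sup>2) F" for j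
    by (rule tendsto_power[OF tendsto_inner[OF tendsto_const assms]])
  then have "((\<lambda>i. \<Sum>j<length bs. (bs ! j \<bullet> u i)\<^sup>2) \<longlongrightarrow> (\<Sum>j<length bs. (bs ! j \<bullet> v)\<^sup>2)) F"
    by (rule tendsto_sum)
  then show ?thesis unfolding coordinate_norm_def L2_set_def by (rule tendsto_real_sqrt)
qed

text \<open>
  For an orthonormal basis of \<open>V\<close>, padded with zero vectors to length \<open>k\<close>, the coordinate norm agrees
  on \<open>V\<close> with the norm; the vectors are then moved into the dense set \<open>Q\<close> by less than \<open>1 / (2 (k + 1))\<close>, which
  changes the coordinate norm by at most half the norm.
\<close>

lemma coordinate_norm_of_subspace:
  fixes V :: "'a::euclidean_space set"
  assumes V: "subspace V" "dim V \<le> k" and Q: "\<And>X. open X \<Longrightarrow> X \<noteq> {} \<Longrightarrow> \<exists>q\<in>Q. q \<in> X"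
  shows "\<exists>bs. length bs = k \<and> set bs \<subseteq> Q \<and> (\<forall>v\<in>V. norm v \<le> 2 * coordinate_norm bs v)"
proof -
  obtain B where B: "B \<subseteq> V" "pairwise orthogonal B" "\<And>b. b \<in> B \<Longrightarrow> norm b = 1"
      "independent B" "card B = dim V" "span B = V"
    using orthonormal_basis_subspace[OF V(1)] by metis
  have finB: "finite B" using B(4) by (rule independent_imp_finite)
  obtain es where es: "set es = B" "distinct es" using finite_distinct_list[OF finB] by blast
  have len: "length es = dim V" using distinct_card[OF es(2)] es(1) B(5) by simp
  define e where "e j = (if j < length es then es ! j else 0)" for j
  have norm_eq: "norm v = L2_set (\<lambda>j. e j \<bullet> v) {..<k}" if "v \<in> V" for v
  proof -
    have orth: "b \<bullet> b' = (if b = b' then 1 else 0)" if "b \<in> B" "b' \<in> B" for b b'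
    proof (cases "b = b'")
      case True
      then show ?thesis using B(3)[OF that(1)] by (simp add: dot_square_norm)
    next
      case False
      then show ?thesis using B(2) that by (auto simp: pairwise_def orthogonal_def)
    qed
    obtain c where c: "v = (\<Sum>b\<in>B. c b *\<^sub>R b)"
      using \<open>v \<in> V\<close> B(6) span_finite[OF finB] by blast
    have inner: "b \<bullet> v = c b" if "b \<in> B" for b
    proof -
      have "b \<bullet> v = (\<Sum>b'\<in>B. if b' = b then c b' else 0)"
        unfolding c inner_sum_right using orth that by (intro sum.cong) auto
      then show ?thesis using finB that by simp
    qed
    have "(norm v)\<^sup>2 = v \<bullet> v" by (rule power2_norm_eq_inner)
    also have "\<dots> = (\<Sum>b\<in>B. c b * (b \<bullet> v))" by (subst c) (simp add: inner_sum_left)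
    also have "\<dots> = (\<Sum>b\<in>B. (b \<bullet> v)\<^sup>2)" using inner by (intro sum.cong) (auto simp: power2_eq_square)
    also have "\<dots> = (\<Sum>j<length es. (es ! j \<bullet> v)\<^sup>2)"
      using sum.reindex_bij_betw[OF bij_betw_nth[OF es(2) refl refl], of "\<lambda>b. (b \<bullet> v)\<^sup>2"] es(1) by simp
    also have "\<dots> = (\<Sum>j<k. (e j \<bullet> v)\<^sup>2)"
      using len V(2) by (intro sum.mono_neutral_cong_left) (auto simp: e_def)
    finally have "norm v = sqrt (\<Sum>j<k. (e j \<bullet> v)\<^sup>2)" by (metis norm_ge_zero real_sqrt_unique)
    then show ?thesis by (simp only: L2_set_def)
  qed
  have "\<exists>q\<in>Q. dist (e j) q < 1 / (2 * (real k + 1))" for j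
    using Q[of "ball (e j) (1 / (2 * (real k + 1)))"] by auto
  then have "\<forall>j. \<exists>q. q \<in> Q \<and> dist (e j) q < 1 / (2 * (real k + 1))" by blast
  from choice[OF this] obtain q where q: "\<And>j. q j \<in> Q" "\<And>j. dist (e j) (q j) < 1 / (2 * (real k + 1))" by blast
  have "norm v \<le> 2 * coordinate_norm (map q [0..<k]) v" if "v \<in> V" for v
  proof -
    have qnorm: "coordinate_norm (map q [0..<k]) v = L2_set (\<lambda>j. q j \<bullet> v) {..<k}"
      unfolding coordinate_norm_def by (rule L2_set_cong) auto
    have "norm v = L2_set (\<lambda>j. q j \<bullet> v + (e j - q j) \<bullet> v) {..<k}"
      using norm_eq[OF that] by (simp add: inner_diff_left)
    also have "\<dots> \<le> L2_set (\<lambda>j. q j \<bullet> v) {..<k} + L2_set (\<lambda>j. (e j - q j) \<bullet> v) {..<k}"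
      by (rule L2_set_triangle_ineq)
    also have "L2_set (\<lambda>j. (e j - q j) \<bullet> v) {..<k} \<le> (\<Sum>j<k. \<bar>(e j - q j) \<bullet> v\<bar>)"
      by (rule L2_set_le_sum_abs)
    also have "\<dots> \<le> (\<Sum>j<k. 1 / (2 * (real k + 1)) * norm v)"
    proof (rule sum_mono)
      fix j
      have "\<bar>(e j - q j) \<bullet> v\<bar> \<le> norm (e j - q j) * norm v" by (rule Cauchy_Schwarz_ineq2)
      also have "\<dots> \<le> 1 / (2 * (real k + 1)) * norm v"
        using q(2)[of j] by (intro mult_right_mono) (auto simp: dist_norm)
      finally show "\<bar>(e j - q j) \<bullet> v\<bar> \<le> 1 / (2 * (real k + 1)) * norm v" .
    qed
    also have "\<dots> = real k / (2 * (real k + 1)) * norm v" by simp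
    also have "\<dots> \<le> 1 / 2 * norm v" by (intro mult_right_mono) (auto simp: field_simps)
    finally show ?thesis unfolding qnorm by simp
  qed
  then show ?thesis using q(1) by (intro exI[of _ "map q [0..<k]"]) auto
qed

context lipschitz_pseudometric
begin

text \<open>
  Otherwise there are points \<open>y i\<close> of the same fibre that tend to \<open>x\<close> and violate the estimate. A limit \<open>v\<close> of
  the unit vectors from \<open>x\<close> towards \<open>y i\<close> has lower slope 0 and is therefore a null direction, but its
  coordinate norm is at most \<open>1 / 3\<close> instead of at least \<open>1 / 2\<close>.
\<close>

lemma fibre_cone_of_dim:
  assumes reg: "regular_point x" and dim: "dim (null_directions x) \<le> k"
    and Q: "\<And>X. open X \<Longrightarrow> X \<noteq> {} \<Longrightarrow> \<exists>q\<in>Q. q \<in> X"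
  shows "\<exists>bs i. length bs = k \<and> set bs \<subseteq> Q \<and>
    (\<forall>y\<in>ball x (1 / real (Suc i)). D x y = 0 \<longrightarrow> dist x y \<le> 3 * coordinate_norm bs (y - x))"
proof -
  have sub: "subspace (null_directions x)" using reg by (simp add: regular_point_def)
  obtain bs where bs: "length bs = k" "set bs \<subseteq> Q"
      "\<And>v. v \<in> null_directions x \<Longrightarrow> norm v \<le> 2 * coordinate_norm bs v"
    using coordinate_norm_of_subspace[OF sub dim Q] by blast
  have "\<exists>i. \<forall>y\<in>ball x (1 / real (Suc i)). D x y = 0 \<longrightarrow> dist x y \<le> 3 * coordinate_norm bs (y - x)"
  proof (rule ccontr)
    assume "\<not> ?thesis"
    then have far: "\<not> (\<forall>y\<in>ball x (1 / real (Suc i)). D x y = 0 \<longrightarrow> dist x y \<le> 3 * coordinate_norm bs (y - x))" for i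
      by blast
    have "\<exists>y. y \<in> ball x (1 / real (Suc i)) \<and> D x y = 0 \<and> 3 * coordinate_norm bs (y - x) < dist x y" for i
      using far[of i] unfolding not_le[symmetric] by blast
    then have "\<forall>i. \<exists>y. y \<in> ball x (1 / real (Suc i)) \<and> D x y = 0 \<and> 3 * coordinate_norm bs (y - x) < dist x y"
      by (rule allI)
    from choice[OF this] obtain y where y: "\<And>i. dist x (y i) < 1 / real (Suc i)" "\<And>i. D x (y i) = 0"
        "\<And>i. 3 * coordinate_norm bs (y i - x) < dist x (y i)"
      unfolding mem_ball by blast
    define t where "t i = dist x (y i)" for i
    have t_pos: "0 < t i" for i
      using y(3)[of i] coordinate_norm_nonneg[of bs "y i - x"] unfolding t_def by linarith
    define u where "u i = (1 / t i) *\<^sub>R (y i - x)" for i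
    have u_norm: "norm (u i) = 1" for i
      using t_pos[of i] by (simp add: u_def t_def dist_norm norm_minus_commute)
    have y_eq: "y i = x + t i *\<^sub>R u i" for i using t_pos[of i] by (simp add: u_def)
    have u_T: "coordinate_norm bs (u i) \<le> 1 / 3" for i
      using y(3)[of i] t_pos[of i] unfolding u_def coordinate_norm_scaleR
      by (simp add: t_def divide_le_eq)
    have "\<forall>i. u i \<in> sphere 0 1" using u_norm by simp
    with compact_sphere[of "0::'a" 1] obtain v s where v: "v \<in> sphere 0 1" "strict_mono s" "(u \<circ> s) \<longlonglongrightarrow> v"
      unfolding compact_def by blast
    have "coordinate_norm bs v \<le> 1 / 3"
      using tendsto_coordinate_norm[OF v(3), of bs] u_T
      by (intro LIMSEQ_le_const2) auto
    have t_lim: "(\<lambda>i. t (s i)) \<longlonglongrightarrow> 0"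
    proof (rule tendsto_sandwich[OF _ _ tendsto_const LIMSEQ_inverse_real_of_nat])
      show "\<forall>\<^sub>F i in sequentially. 0 \<le> t (s i)" using t_pos by (simp add: less_imp_le)
      have "t (s i) \<le> inverse (real (Suc i))" for i
      proof -
        have "i \<le> s i" using v(2) by (rule seq_suble)
        then have "1 / real (Suc (s i)) \<le> 1 / real (Suc i)" by (simp add: frac_le)
        then show ?thesis using y(1)[of "s i"] by (simp add: t_def inverse_eq_divide)
      qed
      then show "\<forall>\<^sub>F i in sequentially. t (s i) \<le> inverse (real (Suc i))" by simp
    qed
    have "lower_slope_less c v x" if "0 < c" for c
      unfolding lower_slope_less_def
    proof (intro allI impI)
      fix r :: real assume "0 < r"
      have "\<forall>\<^sub>F i in sequentially. t (s i) < r" using t_lim \<open>0 < r\<close> by (rule order_tendstoD)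
      moreover have "\<forall>\<^sub>F i in sequentially. dist ((u \<circ> s) i) v < c / L"
        using that L_pos by (intro tendstoD[OF v(3)]) simp
      ultimately have "\<forall>\<^sub>F i in sequentially. t (s i) < r \<and> dist ((u \<circ> s) i) v < c / L"
        by (rule eventually_conj)
      then obtain i where i: "t (s i) < r" "dist (u (s i)) v < c / L"
        by (auto simp: eventually_sequentially)
      have "dist (y (s i)) (x + t (s i) *\<^sub>R v) = t (s i) * dist (u (s i)) v"
        using t_pos[of "s i"] unfolding y_eq by (simp add: dist_norm flip: scaleR_diff_right)
      then have "D x (x + t (s i) *\<^sub>R v) \<le> L * (t (s i) * dist (u (s i)) v)"
        using D_move_right[of x "x + t (s i) *\<^sub>R v" "y (s i)"] y(2)[of "s i"] by simp
      also have "\<dots> = t (s i) * (L * dist (u (s i)) v)" by simp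
      also have "\<dots> < t (s i) * c"
        using i(2) L_pos t_pos[of "s i"] by (intro mult_strict_left_mono) (auto simp: field_simps)
      finally show "\<exists>t>0. t < r \<and> D x (x + t *\<^sub>R v) < c * t"
        using t_pos[of "s i"] i(1) by (intro exI[of _ "t (s i)"]) (simp add: mult.commute)
    qed
    then have "v \<in> null_directions x" using reg unfolding regular_point_def by blast
    then have "norm v \<le> 2 * coordinate_norm bs v" by (rule bs(3))
    then show False using v(1) \<open>coordinate_norm bs v \<le> 1 / 3\<close> by simp
  qed
  then show ?thesis using bs(1,2) by blast
qed

end

text \<open>
  On each piece the linear map given by \<open>b i\<close> is injective, and the parametrization of the piece is its
  inverse.
\<close>

lemma countably_rectifiable_of_pieces:
  fixes S R :: "(real ^ 'n) set" and b :: "'i \<Rightarrow> (real ^ 'n) list"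
  assumes I: "countable I" and S: "S \<subseteq> R \<union> (\<Union>i\<in>I. P i)" and R: "hausdorff_measure (real k) R = 0"
    and len: "\<And>i. i \<in> I \<Longrightarrow> length (b i) = k" and "0 \<le> C"
    and lip: "\<And>i x y. i \<in> I \<Longrightarrow> x \<in> P i \<Longrightarrow> y \<in> P i \<Longrightarrow> dist x y \<le> C * coordinate_norm (b i) (x - y)"
  shows "countably_rectifiable k S"
proof -
  define h :: "'i \<Rightarrow> real ^ 'n \<Rightarrow> nat \<Rightarrow> real" where "h i x j = (if j < k then b i ! j \<bullet> x else 0)" for i x j
  define J where "J = to_nat_on I ` I"
  define i where "i n = from_nat_into I n" for n
  have i: "i n \<in> I" if "n \<in> J" for n using that I by (auto simp: J_def i_def)
  define U where "U n = (if n \<in> J then h (i n) ` P (i n) else {})" for n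
  define g where "g n = inv_into (P (i n)) (h (i n))" for n
  have h_dist: "dist x y \<le> C * L2_set (\<lambda>j. h l x j - h l y j) {..<k}" if "l \<in> I" "x \<in> P l" "y \<in> P l" for l x y
  proof -
    have "coordinate_norm (b l) (x - y) = L2_set (\<lambda>j. h l x j - h l y j) {..<k}"
      unfolding coordinate_norm_def len[OF that(1)]
      by (rule L2_set_cong) (auto simp: h_def inner_diff_right)
    then show ?thesis using lip[OF that] by simp
  qed
  have inj: "inj_on (h l) (P l)" if "l \<in> I" for l
  proof (rule inj_onI)
    fix x y assume xy: "x \<in> P l" "y \<in> P l" "h l x = h l y"
    then have "dist x y \<le> C * L2_set (\<lambda>j. 0) {..<k}" using h_dist[OF that xy(1,2)] by simp
    also have "L2_set (\<lambda>j. 0::real) {..<k} = 0" by (simp add: L2_set_def)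
    finally show "x = y" by simp
  qed
  have top: "U n \<subseteq> topspace (Euclidean_space k)" for n
    by (auto simp: U_def topspace_Euclidean_space h_def)
  have lipg: "\<exists>L\<ge>0. \<forall>x\<in>U n. \<forall>y\<in>U n. dist (g n x) (g n y) \<le> L * L2_set (\<lambda>j. x j - y j) {..<k}" for n
  proof (intro exI[of _ C] conjI ballI \<open>0 \<le> C\<close>)
    fix p q assume pq: "p \<in> U n" "q \<in> U n"
    then have "n \<in> J" by (auto simp: U_def split: if_splits)
    then obtain x y where "x \<in> P (i n)" "p = h (i n) x" "y \<in> P (i n)" "q = h (i n) y"
      using pq by (auto simp: U_def)
    then show "dist (g n p) (g n q) \<le> C * L2_set (\<lambda>j. p j - q j) {..<k}"
      using h_dist[OF i[OF \<open>n \<in> J\<close>]] inv_into_f_f[OF inj[OF i[OF \<open>n \<in> J\<close>]]] by (simp add: g_def)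
  qed
  have "S - (\<Union>n. g n ` U n) \<subseteq> R"
  proof
    fix x assume x: "x \<in> S - (\<Union>n. g n ` U n)"
    show "x \<in> R"
    proof (rule ccontr)
      assume "x \<notin> R"
      moreover have "x \<in> R \<union> (\<Union>i\<in>I. P i)" using x S by blast
      ultimately obtain l where l: "l \<in> I" "x \<in> P l" by auto
      define n where "n = to_nat_on I l"
      have n: "n \<in> J" "i n = l" using l(1) I by (simp_all add: n_def J_def i_def)
      have "h l x \<in> U n" using n l(2) by (simp add: U_def)
      moreover have "g n (h l x) = x" using n inv_into_f_f[OF inj[OF l(1)] l(2)] by (simp add: g_def)
      ultimately have "x \<in> (\<Union>n. g n ` U n)" by (metis UN_I UNIV_I imageI)
      then show False using x by blast
    qed
  qed
  with R have "hausdorff_measure (real k) (S - (\<Union>n. g n ` U n)) = 0"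
    by (rule hausdorff_measure_null_subset)
  then show ?thesis unfolding countably_rectifiable_def using top lipg by blast
qed

text \<open>
  The pieces are indexed by the coordinate map, the scale \<open>1 / (i + 1)\<close> up to which the cone condition
  holds, and the centre of a ball of half this radius, so that any two points of a piece are within
  the scale of each other.
\<close>

lemma countably_rectifiable_fibre:
  fixes S R :: "(real ^ 'n) set"
  assumes D: "lipschitz_pseudometric D L"
    and zero: "\<And>x y. x \<in> S \<Longrightarrow> y \<in> S \<Longrightarrow> D x y = 0"
    and R: "hausdorff_measure (real k) R = 0"
    and reg: "\<And>x. x \<in> S - R \<Longrightarrow> lipschitz_pseudometric.regular_point D x"
    and dim: "\<And>x. x \<in> S - R \<Longrightarrow> dim (lipschitz_pseudometric.null_directions D x) \<le> k"
  shows "countably_rectifiable k S"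
proof -
  interpret lipschitz_pseudometric D L by fact
  obtain Q :: "(real ^ 'n) set" where Q: "countable Q" "\<And>X. open X \<Longrightarrow> X \<noteq> {} \<Longrightarrow> \<exists>q\<in>Q. q \<in> X"
    using countable_dense_setE by blast
  define I where "I = {bs. set bs \<subseteq> Q \<and> length bs = k} \<times> (UNIV :: nat set) \<times> Q"
  define P where "P = (\<lambda>(bs, i, q). {x \<in> S. dist q x < 1 / (2 * real (Suc i)) \<and>
    (\<forall>y\<in>ball x (1 / real (Suc i)). D x y = 0 \<longrightarrow> dist x y \<le> 3 * coordinate_norm bs (y - x))})"
  show ?thesis
  proof (rule countably_rectifiable_of_pieces[where I = I and P = P and b = fst and C = 3, OF _ _ R])
    have "countable {bs. set bs \<subseteq> Q \<and> length bs = k}"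
      by (rule countable_subset[OF _ countable_lists[OF Q(1)]]) (auto simp: lists_eq_set)
    then show "countable I" unfolding I_def using Q(1) by (intro countable_SIGMA) auto
    show "S \<subseteq> R \<union> (\<Union>l\<in>I. P l)"
    proof
      fix x assume x: "x \<in> S"
      show "x \<in> R \<union> (\<Union>l\<in>I. P l)"
      proof (cases "x \<in> R")
        case False
        then obtain bs i where bs: "length bs = k" "set bs \<subseteq> Q"
            "\<forall>y\<in>ball x (1 / real (Suc i)). D x y = 0 \<longrightarrow> dist x y \<le> 3 * coordinate_norm bs (y - x)"
          using fibre_cone_of_dim[OF reg dim Q(2)] x by blast
        have "ball x (1 / (2 * real (Suc i))) \<noteq> {}" by (simp add: add_pos_nonneg)
        then obtain q where q: "q \<in> Q" "q \<in> ball x (1 / (2 * real (Suc i)))" using Q(2)[OF open_ball] by blast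
        have "(bs, i, q) \<in> I" using bs q by (simp add: I_def)
        moreover have "x \<in> P (bs, i, q)" using x q(2) bs(3) unfolding P_def by (simp add: dist_commute)
        ultimately show ?thesis by blast
      qed simp
    qed
    show "length (fst l) = k" if "l \<in> I" for l using that by (auto simp: I_def)
    fix l x y assume l: "l \<in> I" and xy: "x \<in> P l" "y \<in> P l"
    obtain bs i q where l_eq: "l = (bs, i, q)" by (cases l)
    have x: "x \<in> S" "dist q x < 1 / (2 * real (Suc i))" and y: "y \<in> S" "dist q y < 1 / (2 * real (Suc i))"
        "\<forall>x\<in>ball y (1 / real (Suc i)). D y x = 0 \<longrightarrow> dist y x \<le> 3 * coordinate_norm bs (x - y)"
      using xy unfolding l_eq P_def by auto
    have "dist y x \<le> dist q y + dist q x" by (rule dist_triangle3)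
    also have "\<dots> < 1 / (2 * real (Suc i)) + 1 / (2 * real (Suc i))" using x(2) y(2) by (rule add_strict_mono[rotated])
    also have "\<dots> = 1 / real (Suc i)" by (simp add: field_simps)
    finally have "x \<in> ball y (1 / real (Suc i))" by simp
    then have "dist y x \<le> 3 * coordinate_norm bs (x - y)" using y(1,3) x(1) zero by blast
    then show "dist x y \<le> 3 * coordinate_norm (fst l) (x - y)" by (simp add: l_eq dist_commute)
  qed simp
qed

section \<open>From Lipschitz maps to pseudometrics\<close>

text \<open>
  The functions \<open>F a\<close> are the McShane extensions of the distance functions \<open>x \<mapsto> dist (f a) (f x)\<close>, and \<open>D\<close>
  pulls back the supremum distance under the Kuratowski embedding extended in this way. Extending the pseudometric avoids extending the map into a larger target space.
\<close>

lemma lipschitz_pseudometric_extension: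
  fixes f :: "'a::euclidean_space \<Rightarrow> 'x::metric_space"
  assumes L: "0 < L" and f: "L-lipschitz_on A f"
  shows "\<exists>D. lipschitz_pseudometric D L \<and> (\<forall>x\<in>A. \<forall>y\<in>A. D x y = dist (f x) (f y))"
proof (cases "A = {}")
  case True
  have "lipschitz_pseudometric (\<lambda>(x::'a) (y::'a). 0) L" by unfold_locales (use L in auto)
  then show ?thesis using True by blast
next
  case False
  define F where "F a x = (INF b\<in>A. dist (f a) (f b) + L * dist b x)" for a x
  have bdd: "bdd_below ((\<lambda>b. dist (f a) (f b) + L * dist b x) ` A)" for a x
    using L by (intro bdd_belowI2[of _ 0]) auto
  have F_le: "F a x \<le> F a y + L * dist x y" for a x y
  proof -
    have "F a x - L * dist x y \<le> F a y"
      unfolding F_def[of a y]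
    proof (rule cINF_greatest[OF False])
      fix b assume b: "b \<in> A"
      have "F a x \<le> dist (f a) (f b) + L * dist b x" unfolding F_def by (rule cINF_lower[OF bdd b])
      also have "L * dist b x \<le> L * (dist b y + dist x y)"
        using L dist_triangle2[of b x y] by (intro mult_left_mono) auto
      finally show "F a x - L * dist x y \<le> dist (f a) (f b) + L * dist b y" by (simp add: distrib_left)
    qed
    then show ?thesis by simp
  qed
  have F_eq: "F a x = dist (f a) (f x)" if "x \<in> A" for a x
  proof (rule antisym)
    show "F a x \<le> dist (f a) (f x)" using cINF_lower[OF bdd that, of a x] by (simp add: F_def)
    show "dist (f a) (f x) \<le> F a x"
      unfolding F_def
    proof (rule cINF_greatest[OF False])
      fix b assume "b \<in> A"
      then show "dist (f a) (f x) \<le> dist (f a) (f b) + L * dist b x"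
        using lipschitz_onD[OF f \<open>b \<in> A\<close> that] dist_triangle[of "f a" "f x" "f b"] by simp
    qed
  qed
  define D where "D x y = (SUP a\<in>A. \<bar>F a x - F a y\<bar>)" for x y
  have diff: "\<bar>F a x - F a y\<bar> \<le> L * dist x y" for a x y
    using F_le[of a x y] F_le[of a y x] by (simp add: abs_le_iff dist_commute)
  have bddD: "bdd_above ((\<lambda>a. \<bar>F a x - F a y\<bar>) ` A)" for x y
    using diff by (intro bdd_aboveI2)
  have "lipschitz_pseudometric D L"
  proof
    show "0 < L" by fact
    show "D x y = D y x" for x y by (simp add: D_def abs_minus_commute)
    show "D x y \<le> L * dist x y" for x y unfolding D_def by (intro cSUP_least False diff)
    show "D x z \<le> D x y + D y z" for x y z
      unfolding D_def[of x z]
    proof (rule cSUP_least[OF False])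
      fix a assume a: "a \<in> A"
      have "\<bar>F a x - F a z\<bar> \<le> \<bar>F a x - F a y\<bar> + \<bar>F a y - F a z\<bar>" by simp
      also have "\<dots> \<le> D x y + D y z" unfolding D_def by (intro add_mono cSUP_upper[OF a bddD])
      finally show "\<bar>F a x - F a z\<bar> \<le> D x y + D y z" .
    qed
  qed
  moreover have "D x y = dist (f x) (f y)" if xy: "x \<in> A" "y \<in> A" for x y
  proof (rule antisym)
    show "D x y \<le> dist (f x) (f y)"
      unfolding D_def using False
    proof (rule cSUP_least)
      fix a
      show "\<bar>F a x - F a y\<bar> \<le> dist (f x) (f y)"
        unfolding F_eq[OF xy(1)] F_eq[OF xy(2)]
        using abs_dist_diff_le[of "f x" "f a" "f y"] by (simp add: dist_commute)
    qed
    have "\<bar>F x x - F x y\<bar> \<le> D x y" unfolding D_def by (rule cSUP_upper[OF xy(1) bddD])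
    then show "dist (f x) (f y) \<le> D x y" by (simp add: F_eq xy)
  qed
  ultimately show ?thesis by blast
qed

theorem theorem1p5:
  fixes m :: nat
    and A :: "(real ^ 'n) set"
    and f :: "real ^ 'n \<Rightarrow> 'x::metric_space"
  assumes "m \<le> CARD('n)"
    and "A \<in> sets lebesgue"
    and "\<exists>L. L-lipschitz_on A f"
  shows "hausdorff_measure (real m)
           {z. \<not> countably_rectifiable (CARD('n) - m) {x \<in> A. f x = z}} = 0"
proof -
  let ?k = "CARD('n) - m"
  obtain L0 where L0: "L0-lipschitz_on A f" using assms(3) by blast
  define L where "L = max 1 L0"
  have "0 < L" by (simp add: L_def)
  have "L-lipschitz_on A f" using L0 by (rule lipschitz_on_mono) (auto simp: L_def)
  from lipschitz_pseudometric_extension[OF \<open>0 < L\<close> this]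
  obtain D where D: "lipschitz_pseudometric D L" and Df: "\<And>x y. x \<in> A \<Longrightarrow> y \<in> A \<Longrightarrow> D x y = dist (f x) (f y)"
    by blast
  interpret lipschitz_pseudometric D L by fact
  let ?R = "\<lambda>z. {x \<in> A. f x = z \<and> \<not> (regular_point x \<and> dim (null_directions x) \<le> ?k)}"
  have "?k + m = DIM(real ^ 'n)" using assms(1) by simp
  then have "hausdorff_measure (real m) {z. hausdorff_measure (real ?k) (?R z) \<noteq> 0} = 0"
    by (intro hausdorff_null_singular_fibres) (simp_all only: Df)
  moreover have "{z. \<not> countably_rectifiable ?k {x \<in> A. f x = z}}
      \<subseteq> {z. hausdorff_measure (real ?k) (?R z) \<noteq> 0}"
  proof (rule subsetI, rule ccontr)
    fix z
    assume z: "z \<in> {z. \<not> countably_rectifiable ?k {x \<in> A. f x = z}}"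
      and "z \<notin> {z. hausdorff_measure (real ?k) (?R z) \<noteq> 0}"
    then have null: "hausdorff_measure (real ?k) (?R z) = 0" by blast
    have "countably_rectifiable ?k {x \<in> A. f x = z}"
    proof (rule countably_rectifiable_fibre[OF D _ null])
      show "D x y = 0" if "x \<in> {x \<in> A. f x = z}" "y \<in> {x \<in> A. f x = z}" for x y
        using that Df by simp
    qed blast+
    then show False using z by blast
  qed
  ultimately show ?thesis by (rule hausdorff_measure_null_subset)
qed

end
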